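(* Let $m\geq 2$ and $\epsilon>0$. Then for $w<1$ sufficiently close to $1$ (depending on $m$ and $\epsilon$), \[ \dim_H(\mathcal{S}_m(w)+\mathcal{S}_m(w))=2,\qquad \dim_H(\mathcal{S}^{\ast}_m(w)+\mathcal{S}^{\ast}_m(w))\leq 1+\epsilon . \]
   Context: Fix an arbitrary norm $\Vert\cdot\Vert$ on $\mathbb{R}^m$. For $w\geq 0$, $\mathcal{S}_m(w)$ is the set of $\underline{x}\in\mathbb{R}^m$ such that for every $c>0$ there is $Q_0$ such that for all $Q\geq Q_0$ the system $1\leq q\leq Q$, $\Vert q\underline{x}-\underline{p}\Vert\leq cQ^{-w}$ has a solution in integers $q$, $\underline{p}\in\mathbb{Z}^m$. $\mathcal{S}^{\ast}_m(w)$ is the set of $\underline{x}=(\xi_1,\ldots,\xi_m)\in\mathcal{S}_m(w)$ that are totally irrational, i.e. $1,\xi_1,\ldots,\xi_m$ are $\mathbb{Q}$-linearly independent. $\dim_H$ is Hausdorff dimension. *)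

theory Defs
  imports "HOL-Analysis.Analysis" "HOL-Library.Set_Algebras"
begin

definition is_norm :: "('a::real_vector \<Rightarrow> real) \<Rightarrow> bool" where
  "is_norm N \<longleftrightarrow>
     (\<forall>x. 0 \<le> N x) \<and> (\<forall>x. N x = 0 \<longleftrightarrow> x = 0) \<and>
     (\<forall>a x. N (a *\<^sub>R x) = \<bar>a\<bar> * N x) \<and> (\<forall>x y. N (x + y) \<le> N x + N y)"

text \<open>The \<open>s\<close>-th power of the diameter, with the usual convention that a nonempty set has
  \<open>diam\<^sup>0 = 1\<close> (so that the 0-dimensional Hausdorff measure is counting measure), whereas
  \<open>0 powr 0 = 0\<close> in HOL.\<close>

definition diam_pow :: "real \<Rightarrow> 'a::metric_space set \<Rightarrow> real" where
  "diam_pow s U = (if U = {} then 0 else if s = 0 then 1 else diameter U powr s)"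

text \<open>Boundedness of the covering sets has to be required explicitly, since \<^const>\<open>diameter\<close> is
  an unspecified real number on unbounded sets. Finite covers are included, because the
  \<open>U i\<close> may be empty.\<close>

definition hausdorff_premeasure :: "real \<Rightarrow> real \<Rightarrow> 'a::metric_space set \<Rightarrow> ennreal" where
  "hausdorff_premeasure s \<delta> A =
     Inf {(\<Sum>i. ennreal (diam_pow s (U i))) | U :: nat \<Rightarrow> 'a set.
            A \<subseteq> (\<Union>i. U i) \<and> (\<forall>i. bounded (U i) \<and> diameter (U i) \<le> \<delta>)}"

definition hausdorff_measure :: "real \<Rightarrow> 'a::metric_space set \<Rightarrow> ennreal" where
  "hausdorff_measure s A = (SUP \<delta>\<in>{0<..}. hausdorff_premeasure s \<delta> A)"

definition hausdorff_dim :: "'a::metric_space set \<Rightarrow> ennreal" where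
  "hausdorff_dim A = Inf {ennreal s | s. 0 \<le> s \<and> hausdorff_measure s A = 0}"

definition singular_set :: "(real ^ 'm \<Rightarrow> real) \<Rightarrow> real \<Rightarrow> (real ^ 'm::finite) set" where
  "singular_set N w =
     {x. \<forall>c>0. \<exists>Q\<^sub>0::real. \<forall>Q\<ge>Q\<^sub>0. \<exists>(q::int) (p::int ^ 'm).
           1 \<le> q \<and> real_of_int q \<le> Q \<and>
           N (real_of_int q *\<^sub>R x - (\<chi> i. real_of_int (p $ i))) \<le> c * Q powr (- w)}"

text \<open>\<open>\<rat>\<close>-linear independence of the family \<open>1, x\<^sub>1, \<dots>, x\<^sub>m\<close> (as a family, so that repeated
  entries count as dependent).\<close>

definition totally_irrational :: "real ^ 'm::finite \<Rightarrow> bool" where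
  "totally_irrational x \<longleftrightarrow>
     (\<forall>(b::rat) (a::'m \<Rightarrow> rat).
        of_rat b + (\<Sum>i\<in>UNIV. of_rat (a i) * x $ i) = 0 \<longrightarrow> b = 0 \<and> (\<forall>i. a i = 0))"

definition singular_set_irr :: "(real ^ 'm \<Rightarrow> real) \<Rightarrow> real \<Rightarrow> (real ^ 'm::finite) set" where
  "singular_set_irr N w = {x \<in> singular_set N w. totally_irrational x}"

end

theory Submission
  imports Defs
begin

text \<open>
  Let \<open>x\<close> lie in the singular set and on no rational line, and let \<open>q\<^sub>k\<close> be the denominators of
  its best approximations \<open>P\<^sub>k = p\<^sub>k / q\<^sub>k\<close>, with errors \<open>r\<^sub>k = \<parallel>q\<^sub>k x - p\<^sub>k\<parallel>\<close>; then
  \<open>r\<^sub>k\<close> is at most of order \<open>q\<^bsub>k+1\<^esub>\<close> to the power \<open>- w\<close>.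

  (1) Three consecutive integer vectors \<open>(q, p)\<close> have \<open>3 \<times> 3\<close> minors of size at most
  \<open>6 q\<^bsub>k+2\<^esub> r\<^sub>k r\<^bsub>k+1\<^esub>\<close>. If \<open>x\<close> were not approximable to a large order \<open>\<tau>\<close>, then for \<open>w\<close> close
  to 1 these integers would vanish eventually, all \<open>P\<^sub>k\<close> would be collinear and \<open>x\<close> would lie on a
  rational line. So \<open>x\<close> lies in a limsup set of arbitrarily small Hausdorff dimension.

  (2) The line through \<open>P\<^bsub>k-1\<^esub>\<close> and \<open>P\<^sub>k\<close> has height of order at most \<open>q\<^sub>k\<close> to the power \<open>1 - w\<close>.
  Hence at scale \<open>X\<close> to the power \<open>- w\<close> the point \<open>x\<close> is close to one of few rational lines, which
  gives upper box dimension close to 1.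

  By (1) and (2) the sum of two such sets has Hausdorff dimension close to 1. The rest of the
  singular set is covered by countably many rational lines: such a line plus a set as in (1) still
  has dimension close to 1, and two lines contribute dimension at most 2. This value is attained,
  since the coordinate axes are singular by Dirichlet's theorem and two of them span a plane.
\<close>

section \<open>Null sets of Hausdorff measures\<close>

lemma hausdorff_premeasure_le:
  assumes "A \<subseteq> (\<Union>i. U i)" "\<And>i. bounded (U i)" "\<And>i. diameter (U i) \<le> \<delta>"
  shows "hausdorff_premeasure s \<delta> A \<le> (\<Sum>i. ennreal (diam_pow s (U i)))"
  unfolding hausdorff_premeasure_def using assms by (intro Inf_lower) blast

lemma hausdorff_premeasure_less_imp_cover:
  assumes "hausdorff_premeasure s \<delta> A < e"
  obtains U where "A \<subseteq> (\<Union>i::nat. U i)" "\<And>i. bounded (U i)" "\<And>i. diameter (U i) \<le> \<delta>"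
    "(\<Sum>i. ennreal (diam_pow s (U i))) < e"
  using assms unfolding hausdorff_premeasure_def Inf_less_iff by blast

lemma hausdorff_measure_eq_0_iff:
  "hausdorff_measure s A = 0 \<longleftrightarrow> (\<forall>\<delta>>0. hausdorff_premeasure s \<delta> A = 0)"
proof -
  have "hausdorff_measure s A = 0 \<longleftrightarrow> hausdorff_measure s A \<le> 0" by simp
  also have "\<dots> \<longleftrightarrow> (\<forall>\<delta>>0. hausdorff_premeasure s \<delta> A \<le> 0)"
    unfolding hausdorff_measure_def SUP_le_iff by auto
  finally show ?thesis by simp
qed

lemma hausdorff_premeasure_mono:
  assumes "A \<subseteq> B"
  shows "hausdorff_premeasure s \<delta> A \<le> hausdorff_premeasure s \<delta> B"
  unfolding hausdorff_premeasure_def using assms by (intro Inf_superset_mono) blast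

lemma hausdorff_measure_eq_0_mono:
  assumes "A \<subseteq> B" "hausdorff_measure s B = 0"
  shows "hausdorff_measure s A = 0"
  using assms hausdorff_premeasure_mono[OF assms(1)]
  unfolding hausdorff_measure_eq_0_iff by (metis le_zero_eq)

lemma hausdorff_dim_le:
  assumes "0 \<le> s" "hausdorff_measure s A = 0"
  shows "hausdorff_dim A \<le> ennreal s"
  unfolding hausdorff_dim_def using assms by (intro Inf_lower) blast

lemma suminf_ennreal_prod_decode:
  fixes f :: "nat \<times> nat \<Rightarrow> ennreal"
  shows "(\<Sum>i. f (prod_decode i)) = (\<Sum>m. \<Sum>n. f (m, n))"
  using suminf_ennreal_2dimen[of "\<lambda>m. \<Sum>n. f (m, n)" f] by (simp add: comp_def)

text \<open>The \<open>n\<close>-th set is covered at cost below \<open>e / 2 ^ (n + 1)\<close>; the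
  double sequence of covering sets becomes a single one through \<open>prod_decode\<close>.\<close>

lemma hausdorff_measure_UN_eq_0:
  fixes A :: "nat \<Rightarrow> 'a::metric_space set"
  assumes null: "\<And>n. hausdorff_measure s (A n) = 0"
  shows "hausdorff_measure s (\<Union>n. A n) = 0"
  unfolding hausdorff_measure_eq_0_iff
proof (intro allI impI)
  fix \<delta> :: real assume \<delta>: "\<delta> > 0"
  have "hausdorff_premeasure s \<delta> (\<Union>n. A n) \<le> 0 + ennreal e" if e: "e > 0" for e
  proof -
    have "\<exists>U. A n \<subseteq> (\<Union>i::nat. U i) \<and> (\<forall>i. bounded (U i)) \<and> (\<forall>i. diameter (U i) \<le> \<delta>) \<and>
      (\<Sum>i. ennreal (diam_pow s (U i))) < ennreal (e * (1/2) ^ Suc n)" for n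
    proof -
      have "hausdorff_premeasure s \<delta> (A n) < ennreal (e * (1/2) ^ Suc n)"
        using null[of n] \<delta> e unfolding hausdorff_measure_eq_0_iff by (simp add: ennreal_zero_less_mult_iff)
      then show ?thesis using hausdorff_premeasure_less_imp_cover by metis
    qed
    then obtain U where U: "\<And>n. A n \<subseteq> (\<Union>i::nat. U n i)" "\<And>n i. bounded (U n i)"
      "\<And>n i. diameter (U n i) \<le> \<delta>"
      "\<And>n. (\<Sum>i. ennreal (diam_pow s (U n i))) < ennreal (e * (1/2) ^ Suc n)"
      by metis
    define V where "V i = (case prod_decode i of (n, k) \<Rightarrow> U n k)" for i
    have "(\<Union>n. A n) \<subseteq> (\<Union>i. V i)"
    proof
      fix x assume "x \<in> (\<Union>n. A n)"
      then obtain n k where "x \<in> U n k" using U(1) by blast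
      then have "x \<in> V (prod_encode (n, k))" by (simp add: V_def)
      then show "x \<in> (\<Union>i. V i)" by blast
    qed
    then have "hausdorff_premeasure s \<delta> (\<Union>n. A n) \<le> (\<Sum>i. ennreal (diam_pow s (V i)))"
      by (rule hausdorff_premeasure_le) (auto simp: V_def U split: prod.split)
    also have "\<dots> = (\<Sum>n. \<Sum>k. ennreal (diam_pow s (U n k)))"
      using suminf_ennreal_prod_decode[of "\<lambda>(n, k). ennreal (diam_pow s (U n k))"]
      by (simp add: V_def case_prod_unfold)
    also have "\<dots> \<le> (\<Sum>n. ennreal (e * (1/2) ^ Suc n))"
      using U(4) by (intro suminf_le) (auto intro: less_imp_le)
    also have "\<dots> = ennreal e"
    proof (rule suminf_ennreal_eq)
      show "(\<lambda>n. e * (1/2) ^ Suc n) sums e"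
        using sums_mult[OF power_half_series, of e] by simp
    qed (use e in auto)
    finally show ?thesis by simp
  qed
  then show "hausdorff_premeasure s \<delta> (\<Union>n. A n) = 0"
    using ennreal_le_epsilon[of 0] by (metis le_zero_eq)
qed

lemma hausdorff_measure_Union_eq_0:
  assumes "countable I" "\<And>i. i \<in> I \<Longrightarrow> hausdorff_measure s (A i) = 0" "I \<noteq> {}"
  shows "hausdorff_measure s (\<Union>i\<in>I. A i) = 0"
proof -
  have "hausdorff_measure s (\<Union>n. A (from_nat_into I n)) = 0"
    using assms by (intro hausdorff_measure_UN_eq_0) (simp add: from_nat_into)
  moreover have "(\<Union>i\<in>I. A i) \<subseteq> (\<Union>n. A (from_nat_into I n))"
  proof
    fix x assume "x \<in> (\<Union>i\<in>I. A i)"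
    then obtain i where i: "i \<in> I" "x \<in> A i" by blast
    obtain n where "from_nat_into I n = i" using from_nat_into_surj[OF assms(1) i(1)] by blast
    then show "x \<in> (\<Union>n. A (from_nat_into I n))" using i(2) by blast
  qed
  ultimately show ?thesis using hausdorff_measure_eq_0_mono by blast
qed

text \<open>The convergence half of the Borel-Cantelli argument: every tail of the family of balls
  around the points of \<open>F n\<close> covers \<open>A\<close>, and the \<open>s\<close>-th
  powers of the diameters in a tail sum to at most the tail of a convergent series.\<close>

lemma hausdorff_measure_limsup_eq_0:
  fixes F :: "nat \<Rightarrow> 'a::real_normed_vector set"
  assumes s: "s > 0" and fin: "\<And>n. finite (F n)" and r0: "\<And>n. r n \<ge> 0"
    and lim: "r \<longlonglongrightarrow> 0" and sm: "summable (\<lambda>n. card (F n) * r n powr s)"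
    and cov: "\<And>x n0. x \<in> A \<Longrightarrow> \<exists>n\<ge>n0. \<exists>y\<in>F n. dist y x \<le> r n"
  shows "hausdorff_measure s A = 0"
  unfolding hausdorff_measure_eq_0_iff
proof (intro allI impI)
  fix \<delta> :: real assume \<delta>: "\<delta> > 0"
  define a where "a n = card (F n) * (2 * r n) powr s" for n
  have a0: "a n \<ge> 0" for n by (simp add: a_def)
  have a_eq: "a = (\<lambda>n. 2 powr s * (card (F n) * r n powr s))"
    by (auto simp: a_def powr_mult r0 fun_eq_iff)
  have sma: "summable a" unfolding a_eq using sm by (rule summable_mult)
  have diam: "diameter (cball y (r n)) \<le> 2 * r n" for y :: 'a and n
  proof (rule diameter_le)
    fix u v assume "u \<in> cball y (r n)" "v \<in> cball y (r n)"
    then show "norm (u - v) \<le> 2 * r n"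
      using dist_triangle2[of u v y] by (auto simp: dist_norm norm_minus_commute)
  qed (use r0 in auto)
  have "\<exists>h. bij_betw h {0..<card (F n)} (F n)" for n
    using fin ex_bij_betw_nat_finite by blast
  then obtain h where h: "\<And>n. bij_betw (h n) {0..<card (F n)} (F n)" by metis
  have "hausdorff_premeasure s \<delta> A \<le> 0 + ennreal e" if e: "e > 0" for e
  proof -
    obtain N1 where N1: "\<And>n. n \<ge> N1 \<Longrightarrow> norm (\<Sum>i. a (i + n)) < e"
      using suminf_exist_split[OF e sma] by blast
    obtain N2 where N2: "\<And>n. n \<ge> N2 \<Longrightarrow> r n < \<delta> / 2"
      using order_tendstoD(2)[OF lim, of "\<delta>/2"] \<delta> unfolding eventually_sequentially by auto
    define N where "N = max N1 N2"
    \<comment> \<open>The shift by \<open>N\<close> keeps only balls of diameter at most \<delta>.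
      Empty sets pad each finite family to a sequence and contribute 0 to the sum.\<close>
    define U where "U n k = (if k < card (F (n + N)) then cball (h (n + N) k) (r (n + N)) else {})" for n k
    define V where "V i = (case prod_decode i of (n, k) \<Rightarrow> U n k)" for i
    have "A \<subseteq> (\<Union>i. V i)"
    proof
      fix x assume "x \<in> A"
      then obtain n y where n: "n \<ge> N" "y \<in> F n" "dist y x \<le> r n" using cov by blast
      then obtain k where "k < card (F n)" "y = h n k"
        using bij_betw_imp_surj_on[OF h[of n]] by (metis imageE atLeastLessThan_iff)
      then have "x \<in> U (n - N) k" using n by (simp add: U_def)
      then have "x \<in> V (prod_encode (n - N, k))" by (simp add: V_def)
      then show "x \<in> (\<Union>i. V i)" by blast
    qed
    moreover have "bounded (V i)" for i by (simp add: V_def U_def split: prod.split)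
    moreover have "diameter (V i) \<le> \<delta>" for i
    proof -
      have "diameter (U n k) \<le> \<delta>" for n k
      proof (cases "k < card (F (n + N))")
        case True
        have "r (n + N) < \<delta> / 2" by (rule N2) (simp add: N_def)
        then show ?thesis using diam[of "h (n+N) k" "n+N"] True by (simp add: U_def)
      qed (use \<delta> in \<open>simp add: U_def diameter_empty\<close>)
      then show ?thesis by (simp add: V_def split: prod.split)
    qed
    ultimately have "hausdorff_premeasure s \<delta> A \<le> (\<Sum>i. ennreal (diam_pow s (V i)))"
      by (rule hausdorff_premeasure_le)
    also have "\<dots> = (\<Sum>n. \<Sum>k. ennreal (diam_pow s (U n k)))"
      using suminf_ennreal_prod_decode[of "\<lambda>(n, k). ennreal (diam_pow s (U n k))"]
      by (simp add: V_def case_prod_unfold)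
    also have "\<dots> \<le> (\<Sum>n. ennreal (a (n + N)))"
    proof (intro suminf_le)
      fix n
      have dp: "diam_pow s (U n k) \<le> (2 * r (n+N)) powr s" for k
        using diam[of "h (n+N) k" "n+N"] s
        by (auto simp: diam_pow_def U_def intro!: powr_mono2 diameter_ge_0)
      have "(\<Sum>k. ennreal (diam_pow s (U n k))) = (\<Sum>k<card (F (n+N)). ennreal (diam_pow s (U n k)))"
        by (rule suminf_finite) (auto simp: U_def diam_pow_def)
      also have "\<dots> \<le> (\<Sum>k<card (F (n+N)). ennreal ((2 * r (n+N)) powr s))"
        by (intro sum_mono ennreal_leI dp)
      also have "\<dots> = ennreal (a (n + N))" by (simp add: a_def ennreal_of_nat_eq_real_of_nat ennreal_mult)
      finally show "(\<Sum>k. ennreal (diam_pow s (U n k))) \<le> ennreal (a (n + N))" .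
    qed auto
    also have "\<dots> = ennreal (\<Sum>n. a (n + N))"
      using a0 sma by (intro suminf_ennreal2) (auto simp: summable_iff_shift)
    also have "\<dots> \<le> ennreal e"
      using N1[of N] by (intro ennreal_leI) (simp add: N_def)
    finally show ?thesis by simp
  qed
  then show "hausdorff_premeasure s \<delta> A = 0"
    using ennreal_le_epsilon[of 0] by (metis le_zero_eq)
qed

text \<open>Comparison with area: projecting to the coordinates \<open>i\<close> and
  \<open>j\<close> turns a cover of \<open>A\<close> into a cover of the unit square by squares of
  side \<open>2 * d n\<close>. Their area is at most 4 times the \<open>s\<close>-th power of the
  diameter, because \<open>d n \<le> 1\<close> and \<open>s < 2\<close>.\<close>

lemma hausdorff_measure_plane_neq_0:
  fixes i j :: "'m::finite"
  assumes ij: "i \<noteq> j" and s: "0 \<le> s" "s < 2"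
    and A: "\<And>u v. axis i u + axis j v \<in> (A :: (real ^ 'm) set)"
  shows "hausdorff_measure s A \<noteq> 0"
proof
  assume "hausdorff_measure s A = 0"
  \<comment> \<open>The value 1/4 offsets the factor 4 between area and \<open>diam_pow\<close>, so
    that the unit square would get area below 1.\<close>
  then have "hausdorff_premeasure s 1 A < ennreal (1/4)"
    unfolding hausdorff_measure_eq_0_iff by simp
  then obtain U where U: "A \<subseteq> (\<Union>n::nat. U n)" "\<And>n. bounded (U n)" "\<And>n. diameter (U n) \<le> 1"
    "(\<Sum>n. ennreal (diam_pow s (U n))) < ennreal (1/4)"
    using hausdorff_premeasure_less_imp_cover by metis
  define d where "d n = diameter (U n)" for n
  have d: "0 \<le> d n" "d n \<le> 1" for n using U diameter_ge_0 by (auto simp: d_def)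
  define c where "c n = (SOME u. u \<in> U n)" for n
  define B :: "nat \<Rightarrow> (real \<times> real) set" where
    "B n = (if U n = {} then {} else cbox (c n $ i - d n, c n $ j - d n) (c n $ i + d n, c n $ j + d n))" for n
  have "cbox (0,0) (1,1) \<subseteq> (\<Union>n. B n)"
  proof
    fix z :: "real \<times> real" assume "z \<in> cbox (0,0) (1,1)"
    obtain u v where z: "z = (u, v)" by (cases z)
    obtain n where n: "axis i u + axis j v \<in> U n" using A U(1) by blast
    define y where "y = axis i u + axis j v"
    have y: "y $ i = u" "y $ j = v" using ij by (auto simp: y_def axis_def)
    have "c n \<in> U n" unfolding c_def using n by (rule someI)
    then have "dist y (c n) \<le> d n"
      using n diameter_bounded_bound[OF U(2)] unfolding d_def y_def by blast
    moreover have "\<bar>y $ k - c n $ k\<bar> \<le> dist y (c n)" for k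
      using component_le_norm_cart[of "y - c n" k] by (simp add: dist_norm)
    ultimately have "\<bar>y $ k - c n $ k\<bar> \<le> d n" for k by (meson order_trans)
    from this[of i] this[of j] have "z \<in> B n" using n by (auto simp: B_def z y cbox_Pair_eq)
    then show "z \<in> (\<Union>n. B n)" by blast
  qed
  then have "emeasure lborel (cbox (0,0) (1,1::real) :: (real \<times> real) set) \<le> emeasure lborel (\<Union>n. B n)"
    by (intro emeasure_mono) (auto simp: B_def)
  also have "\<dots> \<le> (\<Sum>n. emeasure lborel (B n))"
    by (intro emeasure_subadditive_countably) (auto simp: B_def)
  also have "\<dots> \<le> (\<Sum>n. ennreal 4 * ennreal (diam_pow s (U n)))"
  proof (intro suminf_le)
    fix n
    show "emeasure lborel (B n) \<le> ennreal 4 * ennreal (diam_pow s (U n))"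
    proof (cases "U n = {}")
      case False
      have "emeasure lborel (B n) = ennreal (4 * (d n)\<^sup>2)"
        using False d[of n] by (simp add: B_def emeasure_lborel_cbox_eq Basis_prod_def prod.union_disjoint
            prod.reindex inj_on_def power2_eq_square)
      also have "(d n)\<^sup>2 \<le> diam_pow s (U n)"
      proof (cases "d n = 0")
        case False
        then have "d n powr 2 \<le> d n powr s" using d[of n] s by (intro powr_mono') auto
        moreover have "d n powr 2 = (d n)\<^sup>2" using False d[of n] by (simp)
        moreover have "diam_pow s (U n) = d n powr s" 
          using \<open>U n \<noteq> {}\<close> False by (auto simp: diam_pow_def d_def)
        ultimately show ?thesis by simp
      qed (auto simp: diam_pow_def)
      then have "ennreal (4 * (d n)\<^sup>2) \<le> ennreal (4 * diam_pow s (U n))"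
        by (intro ennreal_leI) simp
      finally show ?thesis by (simp add: ennreal_mult')
    qed (simp add: B_def)
  qed auto
  also have "\<dots> = ennreal 4 * (\<Sum>n. ennreal (diam_pow s (U n)))" by simp
  also have "\<dots> < ennreal 4 * ennreal (1/4)"
    using U(4) by (intro ennreal_mult_strict_left_mono) auto
  also have "\<dots> = ennreal (4 * (1/4))" by (rule ennreal_mult [symmetric]) auto
  also have "\<dots> = 1" by simp
  finally have "emeasure lborel (cbox (0,0) (1,1::real) :: (real \<times> real) set) < 1" .
  moreover have "emeasure lborel (cbox (0,0) (1,1::real) :: (real \<times> real) set) = 1"
    by (simp add: emeasure_lborel_cbox_eq Basis_prod_def prod.union_disjoint
          prod.reindex inj_on_def)
  ultimately show False by simp
qed

section \<open>Best approximations\<close>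

text \<open>The distance from \<open>q x\<close> to the integer lattice in the supremum norm. It is
  0 for \<open>q = 0\<close>, so denominators have to be kept at least 1.\<close>

definition approx_err :: "real ^ 'm::finite \<Rightarrow> nat \<Rightarrow> real" where
  "approx_err x q = Max (range (\<lambda>i. \<bar>real q * x $ i - of_int (round (real q * x $ i))\<bar>))"

definition nearest_point :: "real ^ 'm::finite \<Rightarrow> nat \<Rightarrow> real ^ 'm" where
  "nearest_point x q = (\<chi> i. of_int (round (real q * x $ i)) / real q)"

definition rational_points :: "(real ^ 'm) set" where
  "rational_points = {v. \<forall>i. v $ i \<in> \<rat>}"

text \<open>Direction \<open>0\<close> is allowed, so rational points count as degenerate rational lines.\<close>

definition rational_lines :: "(real ^ 'm) set" where
  "rational_lines = (\<Union>a\<in>rational_points. \<Union>b\<in>rational_points. range (\<lambda>t. a + t *\<^sub>R b))"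

text \<open>A layer of the singular set with constant 1, the supremum norm and an integer threshold,
  so that countably many layers suffice to cover it.\<close>

definition uniform_set :: "real \<Rightarrow> nat \<Rightarrow> (real ^ 'm::finite) set" where
  "uniform_set w n = {x. \<forall>X\<ge>real n. \<exists>q\<ge>1. real q \<le> X \<and> approx_err x q \<le> X powr - w}"

section \<open>Elementary properties of the approximation error\<close>

lemma approx_err_le_iff: "approx_err x q \<le> c \<longleftrightarrow> (\<forall>i. \<bar>real q * x $ i - of_int (round (real q * x $ i))\<bar> \<le> c)"
  unfolding approx_err_def by (subst Max_le_iff) auto

lemma approx_err_ge: "\<bar>real q * x $ i - of_int (round (real q * x $ i))\<bar> \<le> approx_err x q"
  using approx_err_le_iff[of x q "approx_err x q"] by blast

lemma approx_err_nonneg: "0 \<le> approx_err x q"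
  using approx_err_ge[of q x undefined] by linarith

lemma approx_err_le_half: "approx_err x q \<le> 1/2"
  unfolding approx_err_le_iff using of_int_round_abs_le by (metis abs_minus_commute)

lemma approx_err_le_ints:
  assumes "\<And>i. \<bar>real q * x $ i - of_int (p i)\<bar> \<le> c"
  shows "approx_err x q \<le> c"
  unfolding approx_err_le_iff using assms round_diff_minimal by (meson order_trans)

lemma nearest_point_nth: "q \<ge> 1 \<Longrightarrow> real q * nearest_point x q $ i = of_int (round (real q * x $ i))"
  by (simp add: nearest_point_def)

lemma approx_err_ge_nearest_point: "q \<ge> 1 \<Longrightarrow> real q * \<bar>x $ i - nearest_point x q $ i\<bar> \<le> approx_err x q"
  using approx_err_ge[of q x i] nearest_point_nth[of q x i] 
  by (metis abs_mult abs_of_nat right_diff_distrib)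

lemma nearest_point_rational: "nearest_point x q \<in> rational_points"
  by (simp add: rational_points_def nearest_point_def)

lemma rational_points_subset_lines: "rational_points \<subseteq> rational_lines"
proof
  fix v :: "real ^ 'm" assume v: "v \<in> rational_points"
  have "v = v + 0 *\<^sub>R v" by simp
  with v show "v \<in> rational_lines" unfolding rational_lines_def by blast
qed

lemma approx_err_pos:
  assumes "x \<notin> rational_lines" "q \<ge> 1"
  shows "0 < approx_err x q"
proof (rule ccontr)
  assume "\<not> 0 < approx_err x q"
  then have "approx_err x q = 0" using approx_err_nonneg[of x q] by linarith
  then have "x $ i = nearest_point x q $ i" for i
    using approx_err_ge_nearest_point[OF assms(2), of x i] assms(2) by (simp add: mult_le_0_iff)
  then have "x = nearest_point x q" by (simp add: vec_eq_iff)
  then show False using assms(1) nearest_point_rational[of x q] rational_points_subset_lines by auto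
qed

text \<open>The \<open>Q k\<close> are the successive record minima of the error. A further record
  always exists: the current error is positive off the rational lines, while uniform approximability
  yields arbitrarily small errors. The last property holds because the solution for
  \<open>X < Q (Suc k)\<close> precedes the next record, so its error is at least that of
  \<open>Q k\<close>.\<close>

lemma best_approximations:
  fixes x :: "real ^ 'm::finite"
  assumes x: "x \<notin> rational_lines" "x \<in> uniform_set w n" and w: "w > 0"
  obtains Q where "strict_mono Q" "Q 0 = (1::nat)" "\<And>k. approx_err x (Q (Suc k)) < approx_err x (Q k)"
    "\<And>k X. real n \<le> X \<Longrightarrow> X < real (Q (Suc k)) \<Longrightarrow> approx_err x (Q k) \<le> X powr - w"
proof -
  define best where "best q \<longleftrightarrow> q \<ge> 1 \<and> (\<forall>q'. 1 \<le> q' \<longrightarrow> q' < q \<longrightarrow> approx_err x q < approx_err x q')" for q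
  \<comment> \<open>\<open>q'\<close> is the first denominator that improves on \<open>q\<close>.
    Carrying this relation through the dependent choice ensures that no record is skipped.\<close>
  define R where "R q q' \<longleftrightarrow> q < q' \<and> approx_err x q' < approx_err x q \<and> (\<forall>q''. 1 \<le> q'' \<longrightarrow> q'' < q' \<longrightarrow> approx_err x q \<le> approx_err x q'')"
    for q q'
  have step: "\<exists>q'. best q' \<and> R q q'" if q: "best q" for q
  proof -
    have pos: "0 < approx_err x q" using approx_err_pos[OF x(1)] q by (simp add: best_def)
    have "((\<lambda>X. X powr - w) \<longlongrightarrow> 0) at_top"
      using w by (intro tendsto_neg_powr filterlim_ident) auto
    then have "eventually (\<lambda>X. X powr - w < approx_err x q) at_top"
      using pos by (rule order_tendstoD(2))
    then have "eventually (\<lambda>X. X powr - w < approx_err x q \<and> X \<ge> real n) at_top"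
      using eventually_ge_at_top eventually_conj by blast
    then obtain X where X: "X powr - w < approx_err x q" "X \<ge> real n"
      by (metis (no_types, lifting) eventually_at_top_linorder order_refl)
    then obtain q0 where q0: "q0 \<ge> 1" "approx_err x q0 < approx_err x q" 
      using x(2) unfolding uniform_set_def by force
    define q' where "q' = (LEAST q'. 1 \<le> q' \<and> approx_err x q' < approx_err x q)"
    have q': "1 \<le> q'" "approx_err x q' < approx_err x q"
      unfolding q'_def using LeastI[of "\<lambda>q'. 1 \<le> q' \<and> approx_err x q' < approx_err x q" q0] q0 by auto
    have least: "approx_err x q \<le> approx_err x q''" if "1 \<le> q''" "q'' < q'" for q''
      using not_less_Least[of q'' "\<lambda>q'. 1 \<le> q' \<and> approx_err x q' < approx_err x q"] that unfolding q'_def by force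
    have "q < q'"
      using q q' unfolding best_def by (metis less_asym linorder_neqE_nat order.irrefl)
    moreover have "best q'" unfolding best_def using q' least by force
    ultimately show ?thesis unfolding R_def using q' least by blast
  qed
  have "\<exists>Q. \<forall>k. (best (Q k) \<and> (k = 0 \<longrightarrow> Q k = 1)) \<and> R (Q k) (Q (Suc k))"
    by (rule dependent_nat_choice) (use step in \<open>auto simp: best_def\<close>)
  then obtain Q where Q: "\<And>k. best (Q k)" "Q 0 = 1" "\<And>k. R (Q k) (Q (Suc k))" by blast
  show thesis
  proof
    show "strict_mono Q" using Q(3) by (auto simp: strict_mono_Suc_iff R_def)
    show "approx_err x (Q (Suc k)) < approx_err x (Q k)" for k using Q(3)[of k] by (auto simp: R_def)
    show "approx_err x (Q k) \<le> X powr - w" if X: "real n \<le> X" "X < real (Q (Suc k))" for k X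
    proof -
      obtain q where q: "q \<ge> 1" "real q \<le> X" "approx_err x q \<le> X powr - w"
        using x(2) X(1) unfolding uniform_set_def by blast
      then have "q < Q (Suc k)" using X by linarith
      then have "approx_err x (Q k) \<le> approx_err x q" using Q(3)[of k] q(1) by (auto simp: R_def)
      then show ?thesis using q(3) by linarith
    qed
  qed (fact Q(2))
qed

text \<open>The bound is available only for \<open>X\<close> strictly below \<open>q'\<close>, so it
  is applied at \<open>X = q' / 2\<close>, at the price of a factor \<open>2 powr w \<le> 2\<close>.
  The condition \<open>2 * n \<le> q'\<close> keeps this \<open>X\<close> above the
  threshold.\<close>

lemma best_approximation_bound:
  assumes "\<And>X. real n \<le> X \<Longrightarrow> X < real q' \<Longrightarrow> e \<le> X powr - w" "2 * n \<le> q'" "1 \<le> q'" "0 < w" "w < 1"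
  shows "e \<le> 2 * real q' powr - w"
proof -
  have "e \<le> (real q' / 2) powr - w" using assms(2,3) by (intro assms(1)) auto
  also have "\<dots> = 2 powr w * real q' powr - w" by (simp add: powr_divide powr_minus field_simps)
  also have "\<dots> \<le> 2 powr 1 * real q' powr - w" using assms by (intro mult_right_mono powr_mono) auto
  finally show ?thesis by simp
qed

text \<open>For a common point the errors would be \<open>q\<close> and \<open>q'\<close> times the
  same distance, so the larger denominator could not have the smaller error.\<close>

lemma nearest_point_neq:
  assumes "1 \<le> q" "q < q'" "approx_err x q' < approx_err x q"
  shows "nearest_point x q \<noteq> nearest_point x q'"
proof
  assume eq: "nearest_point x q = nearest_point x q'"
  have "approx_err x q \<le> approx_err x q'"
    unfolding approx_err_le_iff
  proof
    fix i
    have "\<bar>real q * x $ i - of_int (round (real q * x $ i))\<bar> = real q * \<bar>x $ i - nearest_point x q $ i\<bar>"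
      using nearest_point_nth[OF assms(1), of x i] by (metis abs_mult abs_of_nat right_diff_distrib)
    also have "\<dots> \<le> real q' * \<bar>x $ i - nearest_point x q' $ i\<bar>"
      using assms eq by (intro mult_mono) auto
    also have "\<dots> \<le> approx_err x q'" using assms by (intro approx_err_ge_nearest_point) auto
    finally show "\<bar>real q * x $ i - of_int (round (real q * x $ i))\<bar> \<le> approx_err x q'" .
  qed
  then show False using assms(3) by simp
qed

text \<open>An integer determinant of absolute value below 1 is 0. Over all \<open>i\<close> and
  \<open>j\<close> this says that the two successive difference vectors are parallel.\<close>

lemma nearest_point_collinear:
  fixes x :: "real ^ 'm::finite"
  assumes le: "1 \<le> a" "a \<le> b" "b \<le> c" "approx_err x c \<le> approx_err x b" "approx_err x b \<le> approx_err x a"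
    and small: "6 * real c * approx_err x a * approx_err x b < 1"
  shows "(nearest_point x b - nearest_point x a) $ i * (nearest_point x c - nearest_point x b) $ j =
         (nearest_point x b - nearest_point x a) $ j * (nearest_point x c - nearest_point x b) $ i"
proof -
  define p where "p q k = round (real q * x $ k)" for q k
  define r where "r q k = real q * x $ k - of_int (p q k)" for q k
  have r: "\<bar>r q k\<bar> \<le> approx_err x q" for q k unfolding r_def p_def by (rule approx_err_ge)
  \<comment> \<open>The determinant with rows \<open>(q, p q i, p q j)\<close>; column operations turn its entries \<open>p\<close> into
    \<open>- r\<close>.\<close>
  define D where "D = int a * (p b i * p c j - p b j * p c i) - int b * (p a i * p c j - p a j * p c i)
      + int c * (p a i * p b j - p a j * p b i)"
  have D1: "of_int D = real a * (r b i * r c j - r b j * r c i) - real b * (r a i * r c j - r a j * r c i)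
      + real c * (r a i * r b j - r a j * r b i)"
    unfolding D_def r_def by (simp add: algebra_simps)
  \<comment> \<open>The errors decrease, so the product of those at \<open>a\<close> and
    \<open>b\<close> is the largest. Three such cofactor terms, each with coefficient 2, produce the
    constant 6.\<close>
  have bd: "\<bar>real q1 * (r q2 i * r q3 j - r q2 j * r q3 i)\<bar> \<le> 2 * (real c * approx_err x a * approx_err x b)"
    if "q1 \<le> c" "approx_err x q2 * approx_err x q3 \<le> approx_err x a * approx_err x b" for q1 q2 q3
  proof -
    have "\<bar>r q2 k * r q3 l\<bar> \<le> approx_err x q2 * approx_err x q3" for k l
      unfolding abs_mult using r approx_err_nonneg by (intro mult_mono) auto
    from this[of i j] this[of j i] have "\<bar>r q2 i * r q3 j - r q2 j * r q3 i\<bar> \<le> 2 * (approx_err x q2 * approx_err x q3)"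
      by linarith
    also have "\<dots> \<le> 2 * (approx_err x a * approx_err x b)" using that by simp
    finally have "\<bar>r q2 i * r q3 j - r q2 j * r q3 i\<bar> \<le> 2 * (approx_err x a * approx_err x b)" .
    then have "real q1 * \<bar>r q2 i * r q3 j - r q2 j * r q3 i\<bar> \<le> real c * (2 * (approx_err x a * approx_err x b))"
      using that by (intro mult_mono) auto
    then show ?thesis by (simp add: abs_mult mult_ac)
  qed
  have "\<bar>of_int D :: real\<bar> \<le> 6 * (real c * approx_err x a * approx_err x b)"
  proof -
    have "approx_err x b * approx_err x c \<le> approx_err x a * approx_err x b" 
      using le approx_err_nonneg[of x] by (metis mult_mono mult.commute)
    moreover have "approx_err x a * approx_err x c \<le> approx_err x a * approx_err x b" 
      using le approx_err_nonneg[of x] by (intro mult_left_mono) auto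
    ultimately show ?thesis
      using bd[of a b c] bd[of b a c] bd[of c a b] le unfolding D1 by linarith
  qed
  then have "\<bar>of_int D :: real\<bar> < 1" using small by simp
  then have "D = 0" by linarith
  \<comment> \<open>Dividing each row by its denominator makes the first column constant;
    subtracting rows then leaves the minor of the difference vectors.\<close>
  moreover have "of_int D = real a * real b * real c * ((nearest_point x b - nearest_point x a) $ i * (nearest_point x c - nearest_point x b) $ j -
         (nearest_point x b - nearest_point x a) $ j * (nearest_point x c - nearest_point x b) $ i)"
  proof -
    have "of_int (p q k) = real q * nearest_point x q $ k" if "q \<in> {a, b, c}" for q k
      using that le nearest_point_nth[of q x k] unfolding p_def by auto
    then show ?thesis unfolding D_def by (simp add: algebra_simps)
  qed
  ultimately show ?thesis using le by simp
qed

text \<open>If no denominator from \<open>K\<close> on worked, the error at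
  \<open>b = Q (Suc k)\<close> would exceed \<open>b powr - \<tau>\<close>. As it is at most
  \<open>2 * c powr - w\<close> for the next denominator \<open>c\<close>, that denominator is
  bounded by a power of \<open>b\<close>. Then the determinants of three successive approximations
  vanish eventually, and \<open>x\<close> is a limit of points on one rational line.\<close>

lemma very_well_approximable:
  fixes x :: "real ^ 'm::finite"
  assumes x: "x \<notin> rational_lines" "x \<in> uniform_set w n" and w: "1/2 \<le> w" "w < 1"
    and \<tau>: "0 < \<tau>" "\<tau> * (1 - w) < w\<^sup>2"
  shows "\<exists>q\<ge>K. 1 \<le> q \<and> approx_err x q \<le> real q powr - \<tau>"
proof (rule ccontr)
  assume "\<not> ?thesis"
  then have neg: "real q powr - \<tau> < approx_err x q" if "q \<ge> K" "1 \<le> q" for q using that by force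
  have w0: "w > 0" using w by simp
  obtain Q where Q: "strict_mono Q" "Q 0 = (1::nat)" "\<And>k. approx_err x (Q (Suc k)) < approx_err x (Q k)"
    "\<And>k X. real n \<le> X \<Longrightarrow> X < real (Q (Suc k)) \<Longrightarrow> approx_err x (Q k) \<le> X powr - w"
    using best_approximations[OF x w0] by blast
  have Q1: "1 \<le> Q k" for k using Q(1,2) by (metis le0 strict_mono_less_eq)
  have Qk: "k \<le> Q k" for k using Q(1) by (rule strict_mono_imp_increasing)
  have Qt: "filterlim (\<lambda>k. real (Q k)) at_top sequentially"
    by (intro filterlim_compose[OF filterlim_real_sequentially] filterlim_subseq Q(1))
  have bound: "approx_err x (Q k) \<le> 2 * real (Q (Suc k)) powr - w" if "2 * n \<le> k" for k
    using Q(4)[of _ k] that Qk[of "Suc k"] Q1 w0 w by (intro best_approximation_bound[of n]) auto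
  \<comment> \<open>The net exponent of \<open>b\<close> in the determinant bound:
    \<open>c powr (1 - w)\<close> costs \<open>\<tau> * (1 - w) / w\<close> and the error at
    \<open>Q k\<close> gains \<open>w\<close>. It is positive exactly by the condition on
    \<tau>.\<close>
  define \<gamma> where "\<gamma> = w - \<tau> * (1 - w) / w"
  have \<gamma>: "\<gamma> > 0" using \<tau> w0 unfolding \<gamma>_def by (simp add: field_simps power2_eq_square)
  \<comment> \<open>Here 48 is 6 from the determinant, 2 * 2 from the two error bounds and 2 from
    \<open>2 powr ((1 - w) / w)\<close>, whose exponent is at most 1 since
    \<open>w \<ge> 1/2\<close>.\<close>
  have "((\<lambda>k. 48 * real (Q (Suc k)) powr - \<gamma>) \<longlongrightarrow> 48 * 0) sequentially"
    using \<gamma> by (intro tendsto_intros tendsto_neg_powr filterlim_compose[OF Qt] filterlim_Suc) auto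
  then have "eventually (\<lambda>k. 48 * real (Q (Suc k)) powr - \<gamma> < 1) sequentially"
    by (rule order_tendstoD(2)) simp
  then obtain k1 where k1: "\<And>k. k \<ge> k1 \<Longrightarrow> 48 * real (Q (Suc k)) powr - \<gamma> < 1"
    unfolding eventually_sequentially by blast
  define k0 where "k0 = max k1 (max (2 * n) K)"
  have small: "6 * real (Q (Suc (Suc k))) * approx_err x (Q k) * approx_err x (Q (Suc k)) < 1" if k: "k \<ge> k0" for k
  proof -
    define b where "b = real (Q (Suc k))"
    define c where "c = real (Q (Suc (Suc k)))"
    have bc: "b > 0" "c > 0" using Q1[of "Suc k"] Q1[of "Suc (Suc k)"] by (auto simp: b_def c_def)
    have eb: "approx_err x (Q (Suc k)) \<le> 2 * c powr - w" unfolding c_def by (rule bound) (use k in \<open>simp add: k0_def\<close>)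
    have ea: "approx_err x (Q k) \<le> 2 * b powr - w" unfolding b_def by (rule bound) (use k in \<open>simp add: k0_def\<close>)
    have "b powr - \<tau> < approx_err x (Q (Suc k))"
      unfolding b_def using Q1 Qk[of "Suc k"] k by (intro neg) (auto simp: k0_def)
    with eb have "b powr - \<tau> \<le> 2 * c powr - w" by simp
    then have cw: "c powr w \<le> 2 * b powr \<tau>" using bc by (simp add: powr_minus field_simps)
    have "c powr (1 - w) = (c powr w) powr ((1 - w) / w)" using w0 by (simp add: powr_powr)
    also have "\<dots> \<le> (2 * b powr \<tau>) powr ((1 - w) / w)" using cw w w0 by (intro powr_mono2) auto
    also have "\<dots> = 2 powr ((1 - w) / w) * b powr (\<tau> * (1 - w) / w)"
      by (simp add: powr_mult powr_powr)
    also have "\<dots> \<le> 2 powr 1 * b powr (\<tau> * (1 - w) / w)"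
      using w w0 by (intro mult_right_mono powr_mono) auto
    finally have c1: "c powr (1 - w) \<le> 2 * b powr (\<tau> * (1 - w) / w)" by simp
    have "6 * c * approx_err x (Q k) * approx_err x (Q (Suc k)) = 6 * c * (approx_err x (Q k) * approx_err x (Q (Suc k)))" by simp
    also have "\<dots> \<le> 6 * c * ((2 * b powr - w) * (2 * c powr - w))"
      using ea eb approx_err_nonneg bc by (intro mult_left_mono mult_mono) auto
    also have "\<dots> = 24 * (c powr 1 * c powr - w) * b powr - w" using bc by simp
    also have "c powr 1 * c powr - w = c powr (1 - w)" by (subst powr_add [symmetric]) simp
    also have "24 * c powr (1 - w) * b powr - w \<le> 24 * (2 * b powr (\<tau> * (1 - w) / w)) * b powr - w"
      using c1 by (intro mult_right_mono mult_left_mono) auto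
    also have "\<dots> = 48 * b powr - \<gamma>" by (simp add: \<gamma>_def flip: powr_add)
    also have "\<dots> < 1" unfolding b_def using k by (intro k1) (simp add: k0_def)
    finally show ?thesis unfolding b_def c_def .
  qed
  define P where "P k = nearest_point x (Q k)" for k
  define u where "u k = P (Suc k) - P k" for k
  have u0: "u k \<noteq> 0" for k
    using nearest_point_neq[of "Q k" "Q (Suc k)" x] Q1 Q(3) Q(1) by (auto simp: u_def P_def strict_mono_Suc_iff)
  \<comment> \<open>All minors of \<open>u k\<close> and \<open>u (Suc k)\<close> vanish and
    \<open>u k\<close> is nonzero, so \<open>u (Suc k)\<close> is a multiple of \<open>u k\<close>.
    Hence all later points lie on the line through \<open>P k0\<close> in direction
    \<open>u k0\<close>.\<close>
  have par: "u k $ i * u (Suc k) $ j = u k $ j * u (Suc k) $ i" if "k \<ge> k0" for k i j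
    unfolding u_def P_def
    using Q(1,3) Q1 small[OF that] by (intro nearest_point_collinear) (auto simp: strict_mono_less_eq less_imp_le)
  have dir: "u k \<in> span {u k0}" if "k \<ge> k0" for k
    using that
  proof (induction k rule: dec_induct)
    case (step k)
    obtain j where j: "u k $ j \<noteq> 0" using u0[of k] by (auto simp: vec_eq_iff)
    have "u (Suc k) = (u (Suc k) $ j / u k $ j) *\<^sub>R u k"
      using par[OF step(1), of _ j] j by (simp add: vec_eq_iff field_simps)
    then show ?case using span_scale step.IH by metis
  qed (simp add: span_base)
  have line: "P k - P k0 \<in> span {u k0}" if "k \<ge> k0" for k
    using that
  proof (induction k rule: dec_induct)
    case (step k)
    have "u k + (P k - P k0) \<in> span {u k0}" by (rule span_add[OF dir[OF step(1)] step.IH])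
    then show ?case by (simp add: u_def)
  qed (simp add: span_zero)
  have lim: "P \<longlonglongrightarrow> x"
  proof (rule vec_tendstoI)
    fix i
    have "((\<lambda>k. 2 * real (Q (Suc k)) powr - w) \<longlongrightarrow> 2 * 0) sequentially"
      using w0 by (intro tendsto_intros tendsto_neg_powr filterlim_compose[OF Qt] filterlim_Suc) auto
    then have g: "((\<lambda>k. 2 * real (Q (Suc k)) powr - w) \<longlongrightarrow> 0) sequentially" by simp
    have "\<bar>P k $ i - x $ i\<bar> \<le> 2 * real (Q (Suc k)) powr - w" if "k \<ge> k0" for k
    proof -
      have "1 * \<bar>x $ i - P k $ i\<bar> \<le> real (Q k) * \<bar>x $ i - P k $ i\<bar>"
        using Q1[of k] by (intro mult_right_mono) auto
      also have "\<dots> \<le> approx_err x (Q k)" unfolding P_def by (rule approx_err_ge_nearest_point[OF Q1])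
      also have "\<dots> \<le> 2 * real (Q (Suc k)) powr - w" using that by (intro bound) (simp add: k0_def)
      finally show ?thesis by (simp add: abs_minus_commute)
    qed
    then have "\<forall>\<^sub>F k in sequentially. norm (P k $ i - x $ i) \<le> 2 * real (Q (Suc k)) powr - w"
      unfolding eventually_sequentially real_norm_def by blast
    then have "((\<lambda>k. P k $ i - x $ i) \<longlongrightarrow> 0) sequentially"
      using g by (rule Lim_null_comparison)
    then show "((\<lambda>k. P k $ i) \<longlongrightarrow> x $ i) sequentially" by (simp add: LIM_zero_iff)
  qed
  \<comment> \<open>The span is closed, so the limit stays on the line, which is rational.\<close>
  have "x - P k0 \<in> span {u k0}"
  proof (rule Lim_in_closed_set[of _ "\<lambda>k. P k - P k0"])
    show "closed (span {u k0})" by (simp add: closed_subspace subspace_span)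
    show "\<forall>\<^sub>F k in sequentially. P k - P k0 \<in> span {u k0}"
      using line unfolding eventually_sequentially by blast
    show "(\<lambda>k. P k - P k0) \<longlonglongrightarrow> x - P k0" by (intro tendsto_intros lim)
  qed simp
  then obtain t where "x - P k0 = t *\<^sub>R u k0" by (auto simp: span_singleton)
  then have "x = P k0 + t *\<^sub>R u k0" by (simp add: algebra_simps)
  moreover have "P k0 \<in> rational_points" "u k0 \<in> rational_points"
    using nearest_point_rational[of x] by (auto simp: P_def u_def rational_points_def)
  ultimately show False using x(1) unfolding rational_lines_def by blast
qed

section \<open>Covering numbers\<close>

text \<open>This forces upper box dimension at most \<open>t\<close>. Unlike bounds on Hausdorff
  dimension, such exponents add up under sums of sets.\<close>

definition box_bounded :: "real \<Rightarrow> 'a::metric_space set \<Rightarrow> bool" where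
  "box_bounded t A \<longleftrightarrow> (\<exists>C. \<exists>\<rho>\<^sub>0>0. \<forall>\<rho>. 0 < \<rho> \<and> \<rho> \<le> \<rho>\<^sub>0 \<longrightarrow>
     (\<exists>F. finite F \<and> real (card F) \<le> C * \<rho> powr - t \<and> (\<forall>x\<in>A. \<exists>y\<in>F. dist y x \<le> \<rho>)))"

text \<open>\<open>P\<close> is a best approximation to \<open>x\<close>. Together with its predecessor it spans an integral line,
  given by \<open>2 \<times> 2\<close> minors \<open>d\<close> (the direction) and \<open>e\<close> (the position). If the denominator of \<open>P\<close>
  is at most \<open>2 n + 1\<close>, there may be no good predecessor, but then any line through \<open>P\<close> will do.\<close>

lemma integral_line_near:
  fixes x :: "real ^ 'm::finite"
  assumes x: "x \<notin> rational_lines" "x \<in> uniform_set w n" and xR: "\<And>i. \<bar>x $ i\<bar> \<le> R"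
    and w: "1/2 \<le> w" "w < 1" and X: "1 \<le> X" "real n \<le> X"
  defines "H \<equiv> 8 * (R + 1) * (real n + 1) * X powr (1 - w)"
  obtains P :: "real ^ 'm" and d e :: "'m \<Rightarrow> int" and j where
    "\<And>i. \<bar>x $ i - P $ i\<bar> \<le> X powr - w" "d j \<noteq> 0" "\<And>i. \<bar>d i\<bar> \<le> \<bar>d j\<bar>"
    "\<And>i. \<bar>real_of_int (d i)\<bar> \<le> H" "\<And>i. \<bar>real_of_int (e i)\<bar> \<le> H"
    "\<And>i. P $ i * of_int (d j) = P $ j * of_int (d i) + of_int (e i)"
proof -
  have w0: "w > 0" using w by simp
  have R: "R \<ge> 0" using xR[of undefined] by linarith
  obtain Q where Q: "strict_mono Q" "Q 0 = (1::nat)" "\<And>k. approx_err x (Q (Suc k)) < approx_err x (Q k)"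
    "\<And>k X. real n \<le> X \<Longrightarrow> X < real (Q (Suc k)) \<Longrightarrow> approx_err x (Q k) \<le> X powr - w"
    using best_approximations[OF x w0] by blast
  have Q1: "1 \<le> Q k" for k using Q(1,2) by (metis le0 strict_mono_less_eq)
  have Qk: "k \<le> Q k" for k using Q(1) by (rule strict_mono_imp_increasing)
  have "\<exists>k. X < real (Q (Suc k))"
  proof -
    obtain k :: nat where "X < k" using reals_Archimedean2 by blast
    then have "X < real (Q (Suc k))" using Qk[of "Suc k"] by linarith
    then show ?thesis ..
  qed
  \<comment> \<open>\<open>Q k \<le> X < Q (Suc k)\<close>: the last best approximation with
    denominator up to \<open>X\<close>.\<close>
  define k where "k = (LEAST k. X < real (Q (Suc k)))"
  have k1: "X < real (Q (Suc k))" unfolding k_def by (rule LeastI_ex) fact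
  have k2: "real (Q k) \<le> X"
  proof (cases k)
    case (Suc l)
    then show ?thesis using not_less_Least[of l "\<lambda>k. X < real (Q (Suc k))"] unfolding k_def by auto
  qed (use Q X in auto)
  define q' where "q' = Q k"
  define P where "P = nearest_point x q'"
  define p' where "p' i = round (real q' * x $ i)" for i
  have q': "1 \<le> q'" "real q' \<le> X" using Q1 k2 by (auto simp: q'_def)
  have p': "real_of_int (p' i) = real q' * P $ i" for i
    using nearest_point_nth[OF q'(1), of x i] by (simp add: P_def p'_def)
  have X1: "1 \<le> X powr (1 - w)" using X w by (intro ge_one_powr_ge_zero) auto
  have Xw: "X powr - w \<le> 1" using X w0 powr_mono[of "-w" 0 X] by simp
  \<comment> \<open>The two roles of \<open>H\<close>: its factor \<open>real n + 1\<close> absorbs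
    small denominators, and \<open>8 * (R + 1) * X powr (1 - w)\<close> bounds the minors in the
    main case.\<close>
  have H1: "8 * (R + 1) * (real n + 1) \<le> H"
    unfolding H_def using X1 R mult_left_mono[of 1 "X powr (1-w)" "8 * (R + 1) * (real n + 1)"] by simp
  have H2: "8 * (R + 1) * X powr (1 - w) \<le> H"
  proof -
    have "8 * (R + 1) * 1 * X powr (1 - w) \<le> 8 * (R + 1) * (real n + 1) * X powr (1 - w)"
      using R by (intro mult_right_mono mult_left_mono) auto
    then show ?thesis unfolding H_def by simp
  qed
  have Px: "\<bar>x $ i - P $ i\<bar> \<le> X powr - w" for i
  proof -
    have "1 * \<bar>x $ i - P $ i\<bar> \<le> real q' * \<bar>x $ i - P $ i\<bar>" using q' by (intro mult_right_mono) auto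
    also have "\<dots> \<le> approx_err x q'" unfolding P_def by (rule approx_err_ge_nearest_point[OF q'(1)])
    also have "\<dots> \<le> X powr - w" unfolding q'_def using X k1 by (intro Q(4))
    finally show ?thesis by simp
  qed
  have PR: "\<bar>P $ i\<bar> \<le> R + 1" for i using Px[of i] xR[of i] Xw by linarith
  show thesis
  proof (cases "q' \<le> 2 * n + 1")
    case True
    \<comment> \<open>Any coordinate serves: the line through \<open>P\<close> parallel to that axis
      has an integral equation with coefficients scaled by the small denominator
      \<open>q'\<close>.\<close>
    define j :: 'm where "j = undefined"
    have qR: "real q' \<le> 2 * real n + 1" using True by linarith
    have b1: "(R + 1) * (2 * real n + 1) \<le> H"
    proof -
      have "(R + 1) * (2 * real n + 1) \<le> (R + 1) * (8 * (real n + 1))"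
        using R by (intro mult_left_mono) auto
      also have "\<dots> = 8 * (R + 1) * (real n + 1)" by (simp only: mult_ac)
      finally show ?thesis using H1 by linarith
    qed
    have b2: "2 * real n + 1 \<le> H"
    proof -
      have "1 * (2 * real n + 1) \<le> (R + 1) * (2 * real n + 1)" using R by (intro mult_right_mono) auto
      then show ?thesis using b1 unfolding mult_1_left by (rule order_trans)
    qed
    show thesis
    proof (rule that[where P = P and j = j and d = "\<lambda>i. if i = j then int q' else 0" and e = "\<lambda>i. if i = j then 0 else p' i"])
      show "\<bar>real_of_int (if i = j then 0 else p' i)\<bar> \<le> H" for i
      proof -
        have "\<bar>real_of_int (p' i)\<bar> \<le> (2 * real n + 1) * (R + 1)"
          unfolding p' abs_mult using qR PR R by (intro mult_mono) auto
        then show ?thesis using b1 b2 by (simp add: mult.commute)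
      qed
    qed (use Px q' p' qR b2 in auto)
  next
    case False
    then have "k \<noteq> 0" using Q(2) unfolding q'_def by (intro notI) simp
    then obtain l where l: "k = Suc l" by (cases k) auto
    define q where "q = Q l"
    have q: "1 \<le> q" "q < q'" "approx_err x q' < approx_err x q"
      using Q1 Q(1,3) by (auto simp: q_def q'_def l strict_mono_Suc_iff)
    define p where "p i = round (real q * x $ i)" for i
    have p: "real_of_int (p i) = real q * nearest_point x q $ i" for i
      using nearest_point_nth[OF q(1), of x i] by (simp add: p_def)
    have eq: "approx_err x q \<le> 2 * real q' powr - w"
      using Q(4)[of _ l] q'(1) False w0 w
      by (intro best_approximation_bound[of n]) (auto simp: q_def q'_def l)
    define d where "d i = int q * p' i - int q' * p i" for i
    have d_eq: "real_of_int (d i) = real q * real q' * (P $ i - nearest_point x q $ i)" for i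
      by (simp add: d_def p p' algebra_simps)
    \<comment> \<open>Inserting \<open>x\<close> between the two points bounds the minor by
      \<open>2 * q'\<close> times the error at \<open>q\<close>, hence by
      \<open>4 * q' powr (1 - w)\<close>.\<close>
    have dX: "\<bar>real_of_int (d i)\<bar> \<le> 4 * X powr (1 - w)" for i
    proof -
      have "real_of_int (d i) = real q' * (real q * (x $ i - nearest_point x q $ i)) - real q * (real q' * (x $ i - P $ i))"
        by (simp add: d_eq algebra_simps)
      also have "\<bar>\<dots>\<bar> \<le> real q' * (real q * \<bar>x $ i - nearest_point x q $ i\<bar>) + real q * (real q' * \<bar>x $ i - P $ i\<bar>)"
        by (rule order_trans[OF abs_triangle_ineq4]) (simp add: abs_mult)
      also have "\<dots> \<le> real q' * approx_err x q + real q' * approx_err x q"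
      proof (intro add_mono mult_left_mono mult_mono)
        show "real q' * \<bar>x $ i - P $ i\<bar> \<le> approx_err x q"
          using approx_err_ge_nearest_point[OF q'(1), of x i] q(3) by (simp add: P_def)
      qed (use approx_err_ge_nearest_point[OF q(1)] q in auto)
      also have "\<dots> \<le> real q' * (4 * real q' powr - w)"
        using eq mult_left_mono[of "approx_err x q" "2 * real q' powr - w" "real q'"] by simp
      also have "\<dots> = 4 * (real q' powr 1 * real q' powr - w)" using q' by simp
      also have "real q' powr 1 * real q' powr - w = real q' powr (1 - w)" by (subst powr_add [symmetric]) simp
      also have "\<dots> \<le> X powr (1 - w)" using q' w by (intro powr_mono2) auto
      finally show ?thesis by simp
    qed
    \<comment> \<open>Using the largest entry of the direction as pivot keeps all slopes
      \<open>d i / d j\<close> at most 1 in absolute value, so a shift in coordinate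
      \<open>j\<close> is not amplified in the others.\<close>
    have "Max (range (\<lambda>i. \<bar>d i\<bar>)) \<in> range (\<lambda>i. \<bar>d i\<bar>)" by (rule Max_in) auto
    then obtain j where "Max (range (\<lambda>i. \<bar>d i\<bar>)) = \<bar>d j\<bar>" by blast
    then have j: "\<bar>d i\<bar> \<le> \<bar>d j\<bar>" for i by (metis Max_ge finite finite_imageI rangeI)
    have dj: "d j \<noteq> 0"
    proof
      assume "d j = 0"
      then have "d i = 0" for i using j[of i] by simp
      then have "P $ i = nearest_point x q $ i" for i using d_eq[of i] q q' by auto
      then have "nearest_point x q = nearest_point x q'" by (simp add: vec_eq_iff P_def)
      then show False using nearest_point_neq[OF q] by simp
    qed
    define e where "e i = p i * p' j - p j * p' i" for i
    have e_eq: "real_of_int (e i) = P $ i * of_int (d j) - P $ j * of_int (d i)" for i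
      by (simp add: e_def d_eq p p' algebra_simps)
    show thesis
    proof (rule that[where P = P and d = d and j = j and e = e])
      show "\<bar>real_of_int (e i)\<bar> \<le> H" for i
      proof -
        have "\<bar>P $ i1 * of_int (d i2)\<bar> \<le> (R + 1) * (4 * X powr (1 - w))" for i1 i2
          unfolding abs_mult using PR dX R by (intro mult_mono) auto
        from this[of i j] this[of j i] show ?thesis using H2 unfolding e_eq by linarith
      qed
      show "\<bar>real_of_int (d i)\<bar> \<le> H" for i
        using dX[of i] H2 R mult_right_mono[of 4 "8 * (R + 1)" "X powr (1 - w)"] by simp
    qed (use Px dj j e_eq in auto)
  qed
qed

section \<open>Counting integer vectors of bounded size\<close>

lemma card_bounded_int:
  assumes "1 \<le> L"
  shows "finite {k::int. \<bar>real_of_int k\<bar> \<le> L}" "real (card {k::int. \<bar>real_of_int k\<bar> \<le> L}) \<le> 3 * L"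
proof -
  have eq: "{k::int. \<bar>real_of_int k\<bar> \<le> L} = {- \<lfloor>L\<rfloor>..\<lfloor>L\<rfloor>}"
    by (auto simp: abs_le_iff) linarith+
  show "finite {k::int. \<bar>real_of_int k\<bar> \<le> L}" unfolding eq by simp
  have "1 \<le> \<lfloor>L\<rfloor>" using assms by (simp add: le_floor_iff)
  then have "real (card {- \<lfloor>L\<rfloor>..\<lfloor>L\<rfloor>}) = 2 * real_of_int \<lfloor>L\<rfloor> + 1" by simp
  also have "\<dots> \<le> 3 * L" using assms of_int_floor_le[of L] by linarith
  finally show "real (card {k::int. \<bar>real_of_int k\<bar> \<le> L}) \<le> 3 * L" unfolding eq .
qed

lemma card_bounded_int_functions:
  assumes "1 \<le> L"
  shows "finite {d::'m::finite \<Rightarrow> int. \<forall>i. \<bar>real_of_int (d i)\<bar> \<le> L}"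
    "real (card {d::'m \<Rightarrow> int. \<forall>i. \<bar>real_of_int (d i)\<bar> \<le> L}) \<le> (3 * L) ^ CARD('m)"
proof -
  have eq: "{d::'m \<Rightarrow> int. \<forall>i. \<bar>real_of_int (d i)\<bar> \<le> L} = PiE UNIV (\<lambda>_. {k. \<bar>real_of_int k\<bar> \<le> L})"
    by (auto simp: PiE_def)
  show "finite {d::'m \<Rightarrow> int. \<forall>i. \<bar>real_of_int (d i)\<bar> \<le> L}"
    unfolding eq using card_bounded_int[OF assms] by (intro finite_PiE) auto
  have "real (card {d::'m \<Rightarrow> int. \<forall>i. \<bar>real_of_int (d i)\<bar> \<le> L}) = real (card {k::int. \<bar>real_of_int k\<bar> \<le> L}) ^ CARD('m)"
    unfolding eq by (simp add: card_PiE)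
  also have "\<dots> \<le> (3 * L) ^ CARD('m)" using card_bounded_int[OF assms] by (intro power_mono) auto
  finally show "real (card {d::'m \<Rightarrow> int. \<forall>i. \<bar>real_of_int (d i)\<bar> \<le> L}) \<le> (3 * L) ^ CARD('m)" .
qed

lemma dist_le_if_components_le:
  fixes x y :: "real ^ 'm::finite"
  assumes "\<And>i. \<bar>x $ i - y $ i\<bar> \<le> r"
  shows "dist x y \<le> real CARD('m) * r"
proof -
  have "dist x y \<le> (\<Sum>i\<in>UNIV. \<bar>(x - y) $ i\<bar>)" unfolding dist_norm by (rule norm_le_l1_cart)
  also have "\<dots> \<le> (\<Sum>i\<in>(UNIV::'m set). r)" using assms by (intro sum_mono) simp
  finally show ?thesis by simp
qed

text \<open>At scale \<open>r = X powr - w\<close> each of the vectors \<open>d\<close> and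
  \<open>e\<close> has at most of order \<open>X powr (m * (1 - w))\<close> values, which gives the
  term \<open>2 * m * (1 - w) / w\<close>. On each line a grid of order \<open>1 / r\<close> points
  suffices, which gives the 1.\<close>

lemma box_bounded_uniform_set:
  fixes R :: real
  assumes w: "1/2 \<le> w" "w < 1" and R: "0 \<le> R"
  shows "box_bounded (1 + 2 * real CARD('m) * (1 - w) / w)
    {x \<in> uniform_set w n - rational_lines. \<forall>i::'m::finite. \<bar>x $ i\<bar> \<le> R}"
proof -
  define m where "m = CARD('m)"
  have m: "m \<ge> 1" by (simp add: m_def Suc_le_eq)
  define t where "t = 1 + 2 * real m * (1 - w) / w"
  have w0: "w > 0" using w by simp
  have t: "t \<ge> 1" using w w0 by (simp add: t_def)
  define G where "G = 8 * (R + 1) * (real n + 1)"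
  have G: "G \<ge> 1" using R mult_mono[of 1 "8 * (R + 1)" 1 "real n + 1"] by (simp add: G_def)
  define C where "C = real m * (3 * G) ^ (2 * m) * (3 * (R + 2)) * (2 * real m) powr t"
  define \<rho>\<^sub>0 where "\<rho>\<^sub>0 = (real n + 1) powr - w"
  have \<rho>0: "\<rho>\<^sub>0 > 0" by (simp add: \<rho>\<^sub>0_def)
  have "\<exists>F::(real ^ 'm) set. finite F \<and> real (card F) \<le> C * \<rho> powr - t \<and>
      (\<forall>x\<in>{x \<in> uniform_set w n - rational_lines. \<forall>i. \<bar>x $ i\<bar> \<le> R}. \<exists>y\<in>F. dist y x \<le> \<rho>)"
    if \<rho>: "0 < \<rho>" "\<rho> \<le> \<rho>\<^sub>0" for \<rho>
  proof -
    \<comment> \<open>Each coordinate will be off by at most \<open>2 * r\<close>, and the distance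
      is bounded by the sum over \<open>m\<close> coordinates.\<close>
    define r where "r = \<rho> / (2 * real m)"
    have r: "r > 0" "r \<le> \<rho>\<^sub>0" using \<rho> m frac_le[of \<rho> \<rho> 1 "2 * real m"] by (auto simp: r_def)
    define X where "X = r powr - (1 / w)"
    have Xr: "X powr - w = r" using r w0 by (simp add: X_def powr_powr)
    have "(real n + 1) = \<rho>\<^sub>0 powr - (1 / w)" using w0 by (simp add: \<rho>\<^sub>0_def powr_powr)
    also have "\<dots> \<le> X" unfolding X_def using r w0 \<rho>0 by (intro powr_mono2') auto
    finally have X: "1 \<le> X" "real n \<le> X" by auto
    have r1: "r \<le> 1" using Xr X w0 powr_mono[of "-w" 0 X] by simp
    define H where "H = G * X powr (1 - w)"
    have "1 \<le> X powr (1 - w)" using X w by (intro ge_one_powr_ge_zero) auto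
    then have H: "H \<ge> 1" unfolding H_def using G mult_mono[of 1 G 1 "X powr (1-w)"] by simp
    define L where "L = (R + 2) / r"
    have L: "L \<ge> 1" unfolding L_def using r r1 R by (simp add: field_simps)
    define D where "D = {d::'m \<Rightarrow> int. \<forall>i. \<bar>real_of_int (d i)\<bar> \<le> H}"
    define Z where "Z = {k::int. \<bar>real_of_int k\<bar> \<le> L}"
    define I where "I = (UNIV :: 'm set) \<times> D \<times> D \<times> Z"
    \<comment> \<open>For data of a line as in \<open>integral_line_near\<close>, this is its point
      with \<open>j\<close>-th coordinate \<open>l * r\<close>. Tuples with \<open>d j = 0\<close>
      merely add points.\<close>
    define f where "f = (\<lambda>(j, d, e, l). (\<chi> i. (of_int l * r * of_int (d i) + of_int (e i)) / of_int (d j)) :: real ^ 'm)"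
    have fin: "finite D" "finite Z" unfolding D_def Z_def
      using card_bounded_int[OF L] card_bounded_int_functions[OF H] by auto
    show ?thesis
    proof (intro exI[of _ "f ` I"] conjI ballI)
      show "finite (f ` I)" using fin by (auto simp: I_def)
      have "card (f ` I) \<le> card I" using fin by (intro card_image_le) (auto simp: I_def)
      then have "real (card (f ` I)) \<le> real (card I)" by simp
      also have "\<dots> = real m * (real (card D) * (real (card D) * real (card Z)))"
        by (simp add: I_def card_cartesian_product m_def)
      also have "\<dots> \<le> real m * ((3 * H) ^ m * ((3 * H) ^ m * (3 * L)))"
        using card_bounded_int[OF L] card_bounded_int_functions[OF H, where 'm = 'm] H
        by (intro mult_left_mono mult_mono) (auto simp: D_def Z_def m_def)
      also have "\<dots> = real m * (3 * G) ^ (2 * m) * (X powr (1 - w)) ^ (2 * m) * (3 * L)"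
        by (simp add: H_def power_mult_distrib power_mult power2_eq_square mult_ac power_even_eq)
      also have "(X powr (1 - w)) ^ (2 * m) = X powr ((1 - w) * (2 * real m))"
        using X by (simp add: powr_powr flip: powr_realpow)
      also have "\<dots> = r powr - (t - 1)"
        unfolding X_def powr_powr
        by (rule arg_cong[where f = "\<lambda>a. r powr a"]) (simp add: t_def mult_ac)
      also have "real m * (3 * G) ^ (2 * m) * r powr - (t - 1) * (3 * L) =
         real m * (3 * G) ^ (2 * m) * (3 * (R + 2)) * (r powr - (t - 1) * r powr - 1)"
        using r by (simp add: L_def powr_minus divide_inverse)
      also have "r powr - (t - 1) * r powr - 1 = r powr - t" by (subst powr_add [symmetric]) simp
      also have "r powr - t = (2 * real m) powr t * \<rho> powr - t"
      proof -
        have "r powr - t = \<rho> powr - t / (2 * real m) powr - t"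
          unfolding r_def by (rule powr_divide)
        then show ?thesis by (simp only: powr_minus_divide [of "2 * real m" t]) simp
      qed
      finally show "real (card (f ` I)) \<le> C * \<rho> powr - t" by (simp add: C_def mult_ac)
    next
      fix x :: "real ^ 'm" assume "x \<in> {x \<in> uniform_set w n - rational_lines. \<forall>i. \<bar>x $ i\<bar> \<le> R}"
      then have x: "x \<notin> rational_lines" "x \<in> uniform_set w n" "\<And>i. \<bar>x $ i\<bar> \<le> R" by auto
      obtain P :: "real ^ 'm" and d e :: "'m \<Rightarrow> int" and j where
        P: "\<And>i. \<bar>x $ i - P $ i\<bar> \<le> r" and dj: "d j \<noteq> 0" "\<And>i. \<bar>d i\<bar> \<le> \<bar>d j\<bar>"
        and de: "\<And>i. \<bar>real_of_int (d i)\<bar> \<le> H" "\<And>i. \<bar>real_of_int (e i)\<bar> \<le> H"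
        and line: "\<And>i. P $ i * of_int (d j) = P $ j * of_int (d i) + of_int (e i)"
        using integral_line_near[OF x w X] unfolding H_def G_def Xr by (metis (no_types, lifting))
      define l where "l = \<lfloor>P $ j / r\<rfloor>"
      have l: "\<bar>P $ j - of_int l * r\<bar> \<le> r"
      proof -
        have "of_int l \<le> P $ j / r" "P $ j / r \<le> of_int l + 1" unfolding l_def by linarith+
        then show ?thesis using r by (simp add: field_simps abs_le_iff)
      qed
      have "\<bar>of_int l * r\<bar> \<le> R + 2" using l P[of j] x(3)[of j] r1 by linarith
      then have lL: "\<bar>real_of_int l\<bar> \<le> L" unfolding L_def using r by (simp add: field_simps abs_mult)
      define y where "y = f (j, d, e, l)"
      have "y \<in> f ` I" unfolding y_def I_def D_def Z_def using de lL by auto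
      moreover have "dist y x \<le> \<rho>"
      proof -
        have "\<bar>y $ i - x $ i\<bar> \<le> 2 * r" for i
        proof -
          have "P $ i - y $ i = (P $ j - of_int l * r) * (of_int (d i) / of_int (d j))"
            using line[of i] dj(1) by (simp add: y_def f_def field_simps)
          also have "\<bar>\<dots>\<bar> \<le> r * 1"
            unfolding abs_mult abs_divide
            using l r dj by (intro mult_mono) (auto simp: divide_le_eq_1 simp flip: of_int_abs)
          finally show ?thesis using P[of i] by linarith
        qed
        then have "dist y x \<le> real m * (2 * r)" unfolding m_def by (rule dist_le_if_components_le)
        then show ?thesis using m by (simp add: r_def)
      qed
      ultimately show "\<exists>y\<in>f ` I. dist y x \<le> \<rho>" by blast
    qed
  qed
  then show ?thesis unfolding box_bounded_def t_def m_def using \<rho>0 by blast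
qed

section \<open>Sumsets\<close>

text \<open>Chooses one cover per radius; outside the admissible range it is just some finite
  set.\<close>

lemma box_boundedE:
  assumes "box_bounded t A"
  obtains C \<rho>\<^sub>0 G where "\<rho>\<^sub>0 > 0" "\<And>\<rho>. finite (G \<rho>)"
    "\<And>\<rho>. 0 < \<rho> \<Longrightarrow> \<rho> \<le> \<rho>\<^sub>0 \<Longrightarrow> real (card (G \<rho>)) \<le> C * \<rho> powr - t"
    "\<And>\<rho> x. 0 < \<rho> \<Longrightarrow> \<rho> \<le> \<rho>\<^sub>0 \<Longrightarrow> x \<in> A \<Longrightarrow> \<exists>y\<in>G \<rho>. dist y x \<le> \<rho>"
proof -
  obtain C \<rho>\<^sub>0 where \<rho>\<^sub>0: "\<rho>\<^sub>0 > 0" and C: "\<And>\<rho>. 0 < \<rho> \<and> \<rho> \<le> \<rho>\<^sub>0 \<Longrightarrow>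
     \<exists>F. finite F \<and> real (card F) \<le> C * \<rho> powr - t \<and> (\<forall>x\<in>A. \<exists>y\<in>F. dist y x \<le> \<rho>)"
    using assms unfolding box_bounded_def by blast
  have "\<exists>F. finite F \<and> (0 < \<rho> \<and> \<rho> \<le> \<rho>\<^sub>0 \<longrightarrow> real (card F) \<le> C * \<rho> powr - t \<and> (\<forall>x\<in>A. \<exists>y\<in>F. dist y x \<le> \<rho>))" for \<rho>
    using C[of \<rho>] by (cases "0 < \<rho> \<and> \<rho> \<le> \<rho>\<^sub>0") auto
  then obtain G where "\<And>\<rho>. finite (G \<rho>) \<and> (0 < \<rho> \<and> \<rho> \<le> \<rho>\<^sub>0 \<longrightarrow>
      real (card (G \<rho>)) \<le> C * \<rho> powr - t \<and> (\<forall>x\<in>A. \<exists>y\<in>G \<rho>. dist y x \<le> \<rho>))"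
    by metis
  then show thesis using that[of \<rho>\<^sub>0 G C] \<rho>\<^sub>0 by blast
qed

text \<open>Sums of centres for radius \<open>\<rho> / 2\<close> serve for radius \<rho>, and the
  numbers of centres multiply.\<close>

lemma box_bounded_plus:
  fixes A B :: "'a::real_normed_vector set"
  assumes "box_bounded s A" "box_bounded t B"
  shows "box_bounded (s + t) (A + B)"
proof -
  obtain C1 r1 G1 where 1: "r1 > 0" "\<And>\<rho>. finite (G1 \<rho>)"
    "\<And>\<rho>. 0 < \<rho> \<Longrightarrow> \<rho> \<le> r1 \<Longrightarrow> real (card (G1 \<rho>)) \<le> C1 * \<rho> powr - s"
    "\<And>\<rho> x. 0 < \<rho> \<Longrightarrow> \<rho> \<le> r1 \<Longrightarrow> x \<in> A \<Longrightarrow> \<exists>y\<in>G1 \<rho>. dist y x \<le> \<rho>"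
    using box_boundedE[OF assms(1)] by metis
  obtain C2 r2 G2 where 2: "r2 > 0" "\<And>\<rho>. finite (G2 \<rho>)"
    "\<And>\<rho>. 0 < \<rho> \<Longrightarrow> \<rho> \<le> r2 \<Longrightarrow> real (card (G2 \<rho>)) \<le> C2 * \<rho> powr - t"
    "\<And>\<rho> x. 0 < \<rho> \<Longrightarrow> \<rho> \<le> r2 \<Longrightarrow> x \<in> B \<Longrightarrow> \<exists>y\<in>G2 \<rho>. dist y x \<le> \<rho>"
    using box_boundedE[OF assms(2)] by metis
  show ?thesis
    unfolding box_bounded_def
  proof (intro exI conjI allI impI)
    show "0 < min r1 r2" using 1 2 by simp
    fix \<rho> assume \<rho>: "0 < \<rho> \<and> \<rho> \<le> min r1 r2"
    then have h: "0 < \<rho> / 2" "\<rho> / 2 \<le> r1" "\<rho> / 2 \<le> r2" by auto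
    define F where "F = (\<lambda>(x, y). x + y) ` (G1 (\<rho>/2) \<times> G2 (\<rho>/2))"
    show "finite F" using 1 2 by (simp add: F_def)
    have "real (card F) \<le> real (card (G1 (\<rho>/2) \<times> G2 (\<rho>/2)))"
      unfolding F_def of_nat_le_iff using 1 2 by (intro card_image_le) simp
    also have "\<dots> = real (card (G1 (\<rho>/2))) * real (card (G2 (\<rho>/2)))" by (simp add: card_cartesian_product)
    also have "\<dots> \<le> (C1 * (\<rho>/2) powr - s) * (C2 * (\<rho>/2) powr - t)"
      using 1(3)[OF h(1,2)] 2(3)[OF h(1,3)] by (intro mult_mono) auto
    also have "\<dots> = C1 * C2 * ((\<rho>/2) powr - s * (\<rho>/2) powr - t)" by simp
    also have "(\<rho>/2) powr - s * (\<rho>/2) powr - t = (\<rho>/2) powr - (s + t)"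
      by (subst powr_add [symmetric]) simp
    also have "\<dots> = \<rho> powr - (s + t) / 2 powr - (s + t)" by (rule powr_divide)
    finally show "real (card F) \<le> C1 * C2 / 2 powr - (s + t) * \<rho> powr - (s + t)" by simp
    show "\<forall>x\<in>A + B. \<exists>y\<in>F. dist y x \<le> \<rho>"
    proof
      fix x assume "x \<in> A + B"
      then obtain a b where ab: "x = a + b" "a \<in> A" "b \<in> B" by (rule set_plus_elim)
      obtain y z where yz: "y \<in> G1 (\<rho>/2)" "dist y a \<le> \<rho>/2" "z \<in> G2 (\<rho>/2)" "dist z b \<le> \<rho>/2"
        using 1(4)[OF h(1,2) ab(2)] 2(4)[OF h(1,3) ab(3)] by blast
      have "dist (y + z) x \<le> \<rho>" 
        unfolding ab using dist_triangle_add[of y z a b] yz by linarith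
      moreover have "y + z \<in> F" using yz by (auto simp: F_def)
      ultimately show "\<exists>y\<in>F. dist y x \<le> \<rho>" by blast
    qed
  qed
qed

lemma box_bounded_segment:
  fixes a b :: "'a::real_normed_vector"
  assumes R: "R \<ge> 0"
  shows "box_bounded 1 ((\<lambda>t. a + t *\<^sub>R b) ` {-R..R})"
proof -
  \<comment> \<open>Adding 1 keeps the grid step \<open>\<rho> / M\<close> well defined when
    \<open>b = 0\<close>.\<close>
  define M where "M = norm b + 1"
  have M: "M > 0" "norm b \<le> M" using norm_ge_zero[of b] unfolding M_def by linarith+
  show ?thesis
    unfolding box_bounded_def
  proof (intro exI conjI allI impI)
    show "(1::real) > 0" by simp
    fix \<rho> :: real assume \<rho>: "0 < \<rho> \<and> \<rho> \<le> 1"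
    define L where "L = (R * M + 1) / \<rho>"
    have RM: "0 \<le> R * M" using R M by simp
    have L: "1 \<le> L" using \<rho> RM by (simp add: L_def)
    define Z where "Z = {k::int. \<bar>real_of_int k\<bar> \<le> L}"
    define F where "F = (\<lambda>l. a + (of_int l * (\<rho> / M)) *\<^sub>R b) ` Z"
    show "finite F" using card_bounded_int(1)[OF L] by (simp add: F_def Z_def)
    have "real (card F) \<le> real (card Z)"
      unfolding F_def of_nat_le_iff using card_bounded_int(1)[OF L] by (intro card_image_le) (simp add: Z_def)
    also have "\<dots> \<le> 3 * L" unfolding Z_def by (rule card_bounded_int(2)[OF L])
    also have "\<dots> = 3 * (R * M + 1) * \<rho> powr - 1" using \<rho> by (simp add: L_def powr_minus divide_inverse)
    finally show "real (card F) \<le> 3 * (R * M + 1) * \<rho> powr - 1" .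
    show "\<forall>x\<in>(\<lambda>t. a + t *\<^sub>R b) ` {-R..R}. \<exists>y\<in>F. dist y x \<le> \<rho>"
    proof
      fix x assume "x \<in> (\<lambda>t. a + t *\<^sub>R b) ` {-R..R}"
      then obtain t where "t \<in> {-R..R}" and tx: "x = a + t *\<^sub>R b" by blast
      then have t: "\<bar>t\<bar> \<le> R" by (simp add: abs_le_iff)
      define l where "l = \<lfloor>t / (\<rho> / M)\<rfloor>"
      define h where "h = \<rho> / M"
      have h: "h > 0" using \<rho> M by (simp add: h_def)
      have "of_int l \<le> t / h" "t / h \<le> of_int l + 1" unfolding l_def h_def by linarith+
      then have lt: "\<bar>of_int l * h - t\<bar> \<le> h" using h by (simp add: field_simps abs_le_iff)
      have "\<bar>t / h\<bar> \<le> R * M / \<rho>" using t h M \<rho> by (simp add: h_def abs_mult field_simps)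
      moreover have "\<bar>real_of_int l\<bar> \<le> \<bar>t / h\<bar> + 1"
        using \<open>of_int l \<le> t / h\<close> \<open>t / h \<le> of_int l + 1\<close> by linarith
      moreover have "1 \<le> 1 / \<rho>" using \<rho> by simp
      ultimately have "\<bar>real_of_int l\<bar> \<le> L" unfolding L_def add_divide_distrib by linarith
      then have "a + (of_int l * h) *\<^sub>R b \<in> F" by (auto simp: F_def Z_def h_def)
      moreover have "dist (a + (of_int l * h) *\<^sub>R b) x \<le> \<rho>"
      proof -
        have "dist (a + (of_int l * h) *\<^sub>R b) x = norm ((of_int l * h - t) *\<^sub>R b)"
          unfolding tx dist_norm by (simp add: algebra_simps)
        also have "\<dots> \<le> h * M" unfolding norm_scaleR using lt M h by (intro mult_mono) auto
        finally show ?thesis using M by (simp add: h_def)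
      qed
      ultimately show "\<exists>y\<in>F. dist y x \<le> \<rho>" by blast
    qed
  qed
qed

text \<open>Along dyadic radii the series is dominated by a geometric one with ratio
  \<open>(1/2) powr (s - t)\<close>, and each sufficiently fine cover already contains all of
  \<open>A\<close>.\<close>

lemma hausdorff_measure_box_bounded_eq_0:
  fixes A :: "'a::real_normed_vector set"
  assumes A: "box_bounded t A" and s: "t < s" "0 < s"
  shows "hausdorff_measure s A = 0"
proof -
  obtain C \<rho>\<^sub>0 G where G: "\<rho>\<^sub>0 > 0" "\<And>\<rho>. finite (G \<rho>)"
    "\<And>\<rho>. 0 < \<rho> \<Longrightarrow> \<rho> \<le> \<rho>\<^sub>0 \<Longrightarrow> real (card (G \<rho>)) \<le> C * \<rho> powr - t"
    "\<And>\<rho> x. 0 < \<rho> \<Longrightarrow> \<rho> \<le> \<rho>\<^sub>0 \<Longrightarrow> x \<in> A \<Longrightarrow> \<exists>y\<in>G \<rho>. dist y x \<le> \<rho>"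
    using box_boundedE[OF A] by metis
  define r where "r n = (1/2 :: real) ^ n" for n
  have r: "r n > 0" for n by (simp add: r_def)
  have lim: "r \<longlonglongrightarrow> 0" unfolding r_def by (rule LIMSEQ_power_zero) simp
  then obtain N where N: "\<And>n. n \<ge> N \<Longrightarrow> r n < \<rho>\<^sub>0"
    using order_tendstoD(2)[OF lim G(1)] unfolding eventually_sequentially by blast
  show ?thesis
  proof (rule hausdorff_measure_limsup_eq_0[where F = "\<lambda>n. G (r n)" and r = r])
    have "summable (\<lambda>n. C * ((1/2) powr (s - t)) ^ n)"
      using s by (intro summable_mult summable_geometric) (simp add: powr01_less_one)
    then show "summable (\<lambda>n. real (card (G (r n))) * r n powr s)"
    proof (rule summable_comparison_test')
      fix n assume n: "n \<ge> N"
      have "real (card (G (r n))) * r n powr s \<le> C * r n powr - t * r n powr s"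
        using G(3)[OF r less_imp_le[OF N[OF n]]] by (intro mult_right_mono) auto
      also have "\<dots> = C * (r n powr - t * r n powr s)" by simp
      also have "r n powr - t * r n powr s = r n powr (s - t)" by (subst powr_add [symmetric]) simp
      also have "\<dots> = ((1/2) powr (s - t)) ^ n"
        by (simp add: r_def powr_powr mult.commute flip: powr_realpow)
      finally show "norm (real (card (G (r n))) * r n powr s) \<le> C * ((1/2) powr (s - t)) ^ n" by simp
    qed
    show "\<exists>n\<ge>n0. \<exists>y\<in>G (r n). dist y x \<le> r n" if "x \<in> A" for x n0
      using G(4)[OF r less_imp_le[OF N[of "max n0 N"]] that] by (metis max.cobounded1 max.cobounded2)
  qed (use G s less_imp_le[OF r] lim in auto)
qed

text \<open>For each \<open>q\<close> there are of order \<open>q powr m\<close> rational points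
  near which \<open>A\<close> may lie within \<open>\<rho> q = q powr - \<tau>\<close>, and of order
  \<open>q powr (\<tau> * t)\<close> centres cover \<open>B\<close> at the same radius. The sums
  give a series of terms \<open>q powr (m - \<tau> * (s - t))\<close>, which converges by
  \<open>conv\<close>.\<close>

lemma hausdorff_measure_plus_eq_0:
  fixes A B :: "(real ^ 'm::finite) set"
  assumes AR: "\<And>x i. x \<in> A \<Longrightarrow> \<bar>x $ i\<bar> \<le> R"
    and A: "\<And>x K. x \<in> A \<Longrightarrow> \<exists>q\<ge>K. 1 \<le> q \<and> approx_err x q \<le> real q powr - \<tau>"
    and B: "box_bounded t B" and R: "0 \<le> R" and \<tau>: "0 < \<tau>" and s: "0 < s"
    and conv: "real CARD('m) + 1 < \<tau> * (s - t)"
  shows "hausdorff_measure s (A + B) = 0"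
proof -
  define m where "m = CARD('m)"
  obtain C \<rho>\<^sub>0 G where G: "\<rho>\<^sub>0 > 0" "\<And>\<rho>. finite (G \<rho>)"
    "\<And>\<rho>. 0 < \<rho> \<Longrightarrow> \<rho> \<le> \<rho>\<^sub>0 \<Longrightarrow> real (card (G \<rho>)) \<le> C * \<rho> powr - t"
    "\<And>\<rho> x. 0 < \<rho> \<Longrightarrow> \<rho> \<le> \<rho>\<^sub>0 \<Longrightarrow> x \<in> B \<Longrightarrow> \<exists>y\<in>G \<rho>. dist y x \<le> \<rho>"
    using box_boundedE[OF B] by metis
  define \<rho> where "\<rho> q = real q powr - \<tau>" for q
  \<comment> \<open>The \<open>m\<close> comes from passing from coordinates to distance in the
    summand from \<open>A\<close>, the 1 from the ball covering the summand from
    \<open>B\<close>.\<close>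
  define r where "r q = (real m + 1) * \<rho> q" for q
  have lim: "\<rho> \<longlonglongrightarrow> 0"
    unfolding \<rho>_def using \<tau> by (intro tendsto_neg_powr filterlim_real_sequentially) auto
  obtain N0 where N0: "\<And>q. q \<ge> N0 \<Longrightarrow> \<rho> q < \<rho>\<^sub>0"
    using order_tendstoD(2)[OF lim G(1)] unfolding eventually_sequentially by blast
  define N where "N = max 1 N0"
  define D where "D q = {p::'m \<Rightarrow> int. \<forall>i. \<bar>real_of_int (p i)\<bar> \<le> (R + 1) * real q}" for q
  \<comment> \<open>Small \<open>q\<close> are dropped because the counting bounds for
    \<open>D q\<close> and \<open>G (\<rho> q)\<close> are available from \<open>N\<close>
    on.\<close>
  define F where "F q = (if q \<ge> N then (\<lambda>(p, y). (\<chi> i. of_int (p i) / real q) + y) ` (D q \<times> G (\<rho> q)) else {})" for q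
  have DL: "1 \<le> (R + 1) * real q" if "q \<ge> N" for q
    using that R mult_mono[of 1 "R + 1" 1 "real q"] by (simp add: N_def)
  have \<rho>N: "0 < \<rho> q" "\<rho> q \<le> \<rho>\<^sub>0" if "q \<ge> N" for q
    using that N0[of q] by (auto simp: \<rho>_def N_def)
  show ?thesis
  proof (rule hausdorff_measure_limsup_eq_0[where F = F and r = r])
    show "0 < s" by fact
    show "finite (F q)" for q
      using G(2) card_bounded_int_functions(1)[OF DL, of q, where 'm = 'm] by (auto simp: F_def D_def)
    show "0 \<le> r q" for q by (simp add: r_def \<rho>_def)
    show "r \<longlonglongrightarrow> 0" unfolding r_def using lim by (rule tendsto_mult_right_zero)
    define K where "K = (3 * (R + 1)) ^ m * C * (real m + 1) powr s"
    have "summable (\<lambda>q. K * real q powr (real m - \<tau> * (s - t)))"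
      using conv by (intro summable_mult) (simp add: summable_real_powr_iff m_def)
    then show "summable (\<lambda>q. real (card (F q)) * r q powr s)"
    proof (rule summable_comparison_test')
      fix q assume q: "q \<ge> N"
      then have q0: "real q > 0" by (simp add: N_def)
      have "card (F q) \<le> card (D q \<times> G (\<rho> q))"
        unfolding F_def if_P[OF q]
        using G(2) card_bounded_int_functions(1)[OF DL[OF q], where 'm = 'm]
        by (intro card_image_le) (simp add: D_def)
      then have "real (card (F q)) \<le> real (card (D q)) * real (card (G (\<rho> q)))"
        by (metis card_cartesian_product of_nat_le_iff of_nat_mult)
      also have "\<dots> \<le> (3 * ((R + 1) * real q)) ^ m * (C * \<rho> q powr - t)"
        using card_bounded_int_functions(2)[OF DL[OF q], where 'm = 'm] G(3)[OF \<rho>N[OF q]] R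
        by (intro mult_mono) (auto simp: D_def m_def)
      finally have "real (card (F q)) * r q powr s \<le>
          (3 * ((R + 1) * real q)) ^ m * (C * \<rho> q powr - t) * r q powr s"
        by (intro mult_right_mono) auto
      also have "r q powr s = (real m + 1) powr s * \<rho> q powr s"
        unfolding r_def by (rule powr_mult)
      also have "(3 * ((R + 1) * real q)) ^ m = (3 * (R + 1)) ^ m * real q powr real m"
        using q0 by (simp only: mult.assoc [symmetric] power_mult_distrib powr_realpow)
      also have "(3 * (R + 1)) ^ m * real q powr real m * (C * \<rho> q powr - t) * ((real m + 1) powr s * \<rho> q powr s)
          = K * (real q powr real m * (\<rho> q powr - t * \<rho> q powr s))"
        by (simp only: K_def mult_ac)
      also have "\<rho> q powr - t * \<rho> q powr s = \<rho> q powr (s - t)"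
        by (subst powr_add [symmetric]) simp
      also have "real q powr real m * \<rho> q powr (s - t) = real q powr (real m - \<tau> * (s - t))"
        unfolding \<rho>_def powr_powr by (subst powr_add [symmetric]) simp
      finally show "norm (real (card (F q)) * r q powr s) \<le> K * real q powr (real m - \<tau> * (s - t))"
        by (simp add: r_def powr_mult)
    qed
    fix x q0 assume "x \<in> A + B"
    then obtain a b where ab: "x = a + b" "a \<in> A" "b \<in> B" by (rule set_plus_elim)
    obtain q where q: "q \<ge> max q0 N" "1 \<le> q" "approx_err a q \<le> \<rho> q"
      using A[OF ab(2)] unfolding \<rho>_def by blast
    then have qN: "q \<ge> N" by simp
    obtain y where y: "y \<in> G (\<rho> q)" "dist y b \<le> \<rho> q" using G(4)[OF \<rho>N[OF qN] ab(3)] by blast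
    define p where "p i = round (real q * a $ i)" for i
    have nearest_point: "nearest_point a q = (\<chi> i. of_int (p i) / real q)" by (simp add: nearest_point_def p_def)
    have "\<bar>nearest_point a q $ i - a $ i\<bar> \<le> \<rho> q" for i
    proof -
      have "1 * \<bar>a $ i - nearest_point a q $ i\<bar> \<le> real q * \<bar>a $ i - nearest_point a q $ i\<bar>" using q by (intro mult_right_mono) auto
      also have "\<dots> \<le> \<rho> q" using approx_err_ge_nearest_point[OF q(2), of a i] q(3) by linarith
      finally show ?thesis by (simp add: abs_minus_commute)
    qed
    then have "dist (nearest_point a q) a \<le> real m * \<rho> q" unfolding m_def by (rule dist_le_if_components_le)
    then have "dist (nearest_point a q + y) x \<le> r q"
      unfolding ab r_def using dist_triangle_add[of "nearest_point a q" y a b] y(2) by (simp add: algebra_simps)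
    moreover have "p \<in> D q"
    proof -
      have "\<bar>real_of_int (p i)\<bar> \<le> (R + 1) * real q" for i
      proof -
        have "\<bar>real_of_int (p i)\<bar> \<le> \<bar>real q * a $ i\<bar> + 1"
          using approx_err_ge[of q a i] approx_err_le_half[of a q] unfolding p_def by linarith
        also have "\<dots> \<le> real q * R + real q"
          unfolding abs_mult using AR[OF ab(2)] q by (intro add_mono mult_mono) auto
        finally show ?thesis by (simp add: algebra_simps)
      qed
      then show ?thesis by (simp add: D_def)
    qed
    then have "nearest_point a q + y \<in> F q" unfolding F_def nearest_point using qN y(1) by force
    ultimately show "\<exists>n\<ge>q0. \<exists>y\<in>F n. dist y x \<le> r n" using q(1) by (meson max.boundedE)
  qed
qed

text \<open>Reduces a sumset to pairs of pieces, so that each pair can be treated by its own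
  dimension estimate.\<close>

lemma hausdorff_measure_Union_plus_eq_0:
  fixes A :: "'a::{metric_space, plus} set"
  assumes "A \<subseteq> \<Union>\<A>" "countable \<A>" "\<A> \<noteq> {}"
    and "\<And>X Y. X \<in> \<A> \<Longrightarrow> Y \<in> \<A> \<Longrightarrow> hausdorff_measure s (X + Y) = 0"
  shows "hausdorff_measure s (A + A) = 0"
proof (rule hausdorff_measure_eq_0_mono)
  show "A + A \<subseteq> (\<Union>Z\<in>\<A> \<times> \<A>. fst Z + snd Z)"
  proof
    fix x assume "x \<in> A + A"
    then obtain a b where ab: "x = a + b" "a \<in> A" "b \<in> A" by (rule set_plus_elim)
    then obtain X Y where "X \<in> \<A>" "Y \<in> \<A>" "a \<in> X" "b \<in> Y" using assms(1) by blast
    then show "x \<in> (\<Union>Z\<in>\<A> \<times> \<A>. fst Z + snd Z)"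
      unfolding ab by (intro UN_I[of "(X, Y)"]) (auto intro: set_plus_intro)
  qed
  show "hausdorff_measure s (\<Union>Z\<in>\<A> \<times> \<A>. fst Z + snd Z) = 0"
    using assms by (intro hausdorff_measure_Union_eq_0) auto
qed

section \<open>The singular sets\<close>

text \<open>Equivalence of norms by compactness: \<open>N\<close> is Lipschitz, so it attains a
  minimum on the Euclidean unit sphere, which is positive.\<close>

lemma is_norm_component_bound:
  fixes N :: "real ^ 'm::finite \<Rightarrow> real"
  assumes N: "is_norm N"
  obtains K where "K > 0" "\<And>y i. \<bar>y $ i\<bar> \<le> K * N y"
proof -
  have nonneg: "0 \<le> N x" and zero: "N x = 0 \<longleftrightarrow> x = 0" and scale: "N (a *\<^sub>R x) = \<bar>a\<bar> * N x"
    and tri: "N (x + y) \<le> N x + N y" for a x y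
    using N unfolding is_norm_def by auto
  define M where "M = (\<Sum>i\<in>UNIV. N (axis i 1))"
  have sum_le: "N (\<Sum>i\<in>I. f i) \<le> (\<Sum>i\<in>I. N (f i))" if "finite I" for I :: "'m set" and f
    using that
  proof (induction I)
    case empty
    then show ?case using zero[of 0] by simp
  next
    case (insert i I)
    then show ?case using tri[of "f i" "\<Sum>i\<in>I. f i"] by simp
  qed
  have upper: "N y \<le> M * norm y" for y
  proof -
    have "y = (\<Sum>i\<in>UNIV. (y $ i) *\<^sub>R axis i 1)"
      using basis_expansion[of y] by (simp add: scalar_mult_eq_scaleR)
    then have "N y \<le> (\<Sum>i\<in>UNIV. N ((y $ i) *\<^sub>R axis i 1))" using sum_le[OF finite] by metis
    also have "\<dots> \<le> (\<Sum>i\<in>UNIV. norm y * N (axis i 1))"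
      unfolding scale using component_le_norm_cart nonneg by (intro sum_mono mult_right_mono) auto
    finally show ?thesis by (simp add: M_def sum_distrib_right sum_distrib_left mult.commute)
  qed
  have "M-lipschitz_on UNIV N"
  proof (rule lipschitz_onI)
    fix x y
    have "N x \<le> N y + M * dist x y" using tri[of y "x - y"] upper[of "x - y"] by (simp add: dist_norm)
    moreover have "N y \<le> N x + M * dist x y"
      using tri[of x "y - x"] upper[of "y - x"] by (simp add: dist_norm norm_minus_commute)
    ultimately show "dist (N x) (N y) \<le> M * dist x y" by (simp add: dist_real_def abs_le_iff)
  qed (use nonneg in \<open>auto simp: M_def intro: sum_nonneg\<close>)
  then have cont: "continuous_on (sphere 0 1) N"
    by (meson lipschitz_on_continuous_on continuous_on_subset subset_UNIV)
  have "axis undefined 1 \<in> sphere (0 :: real ^ 'm) 1" by simp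
  then obtain z where z: "z \<in> sphere 0 1" "\<And>y. y \<in> sphere 0 1 \<Longrightarrow> N z \<le> N y"
    using continuous_attains_inf[OF compact_sphere _ cont] by blast
  have "z \<noteq> 0" using z(1) by auto
  then have Nz: "N z > 0" using nonneg[of z] zero[of z] by linarith
  have "norm y \<le> 1 / N z * N y" for y
  proof (cases "y = 0")
    case False
    have "N z \<le> N ((1 / norm y) *\<^sub>R y)" using False by (intro z(2)) simp
    then show ?thesis using False Nz by (simp add: scale field_simps)
  qed (use zero[of 0] in simp)
  then have "\<bar>y $ i\<bar> \<le> 1 / N z * N y" for y i
    using component_le_norm_cart[of y i] by (meson order_trans)
  then show thesis using that[of "1 / N z"] Nz by simp
qed

text \<open>The definition of the singular set is used with \<open>c = 1 / K\<close>, which cancels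
  the constant \<open>K\<close> between \<open>N\<close> and the coordinates.\<close>

lemma singular_set_subset_uniform_set:
  fixes N :: "real ^ 'm::finite \<Rightarrow> real"
  assumes N: "is_norm N"
  shows "singular_set N w \<subseteq> (\<Union>n. uniform_set w n)"
proof
  fix x assume x: "x \<in> singular_set N w"
  obtain K where K: "K > 0" "\<And>y i. \<bar>y $ i\<bar> \<le> K * N y" using is_norm_component_bound[OF N] by blast
  obtain Q0 where Q0: "\<And>X. X \<ge> Q0 \<Longrightarrow> \<exists>(q::int) (p::int ^ 'm). 1 \<le> q \<and> real_of_int q \<le> X \<and>
       N (real_of_int q *\<^sub>R x - (\<chi> i. real_of_int (p $ i))) \<le> 1 / K * X powr (- w)"
    using x K(1) unfolding singular_set_def by (smt (verit) mem_Collect_eq zero_less_divide_1_iff)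
  have "x \<in> uniform_set w (nat \<lceil>Q0\<rceil>)"
    unfolding uniform_set_def
  proof (intro CollectI allI impI)
    fix X assume "real (nat \<lceil>Q0\<rceil>) \<le> X"
    then have "Q0 \<le> X" by linarith
    then obtain q :: int and p :: "int ^ 'm" where q: "1 \<le> q" "real_of_int q \<le> X"
      "N (real_of_int q *\<^sub>R x - (\<chi> i. real_of_int (p $ i))) \<le> 1 / K * X powr (- w)"
      using Q0 by blast
    have "approx_err x (nat q) \<le> X powr - w"
    proof (rule approx_err_le_ints[where p = "\<lambda>i. p $ i"])
      fix i
      have "\<bar>real_of_int q * x $ i - of_int (p $ i)\<bar> \<le> K * N (real_of_int q *\<^sub>R x - (\<chi> i. real_of_int (p $ i)))"
        using K(2)[of "real_of_int q *\<^sub>R x - (\<chi> i. real_of_int (p $ i))" i] by simp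
      also have "\<dots> \<le> K * (1 / K * X powr (- w))" using q K by (intro mult_left_mono) auto
      finally show "\<bar>real (nat q) * x $ i - of_int (p $ i)\<bar> \<le> X powr - w" using q(1) K(1) by simp
    qed
    then show "\<exists>q\<ge>1. real q \<le> X \<and> approx_err x q \<le> X powr - w"
      using q by (intro exI[of _ "nat q"]) auto
  qed
  then show "x \<in> (\<Union>n. uniform_set w n)" by blast
qed

text \<open>Only one real number has to be approximated. Dirichlet's theorem does this with exponent
  1, and for \<open>w < 1\<close> the surplus \<open>Q powr (1 - w)\<close> beats every
  constant.\<close>

lemma axis_in_singular_set:
  fixes N :: "real ^ 'm::finite \<Rightarrow> real"
  assumes N: "is_norm N" and w: "w < 1"
  shows "axis i u \<in> singular_set N w"
  unfolding singular_set_def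
proof (intro CollectI allI impI)
  fix c :: real assume c: "c > 0"
  define M where "M = N (axis i 1)"
  have M: "M > 0" using N axis_eq_0_iff[of i "1::real"] unfolding M_def is_norm_def by (metis less_eq_real_def zero_neq_one)
  \<comment> \<open>From \<open>Q0\<close> on, \<open>2 * M / c \<le> Q powr (1 - w)\<close>; the 2
    comes from replacing \<open>Q\<close> by its integer part.\<close>
  define Q0 where "Q0 = max 1 ((2 * M / c) powr (1 / (1 - w)))"
  have "\<exists>(q::int) (p::int ^ 'm). 1 \<le> q \<and> real_of_int q \<le> Q \<and>
       N (real_of_int q *\<^sub>R axis i u - (\<chi> k. real_of_int (p $ k))) \<le> c * Q powr (- w)"
    if Q: "Q \<ge> Q0" for Q
  proof -
    have Q1: "Q \<ge> 1" using Q by (simp add: Q0_def)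
    define n where "n = nat \<lfloor>Q\<rfloor>"
    have "real n = of_int \<lfloor>Q\<rfloor>" "1 \<le> \<lfloor>Q\<rfloor>" using Q1 by (auto simp: n_def)
    then have n: "n > 0" "real n \<le> Q" "Q \<le> 2 * real n" by linarith+
    obtain h k where hk: "0 < k" "k \<le> int n" "\<bar>of_int k * u - of_int h\<bar> < 1 / real n"
      using Dirichlet_approx[OF n(1), of u] by blast
    define p :: "int ^ 'm" where "p = axis i h"
    have eq: "real_of_int k *\<^sub>R axis i u - (\<chi> l. real_of_int (p $ l)) = (of_int k * u - of_int h) *\<^sub>R axis i 1"
      by (simp add: vec_eq_iff p_def axis_def)
    have "N (real_of_int k *\<^sub>R axis i u - (\<chi> l. real_of_int (p $ l))) = \<bar>of_int k * u - of_int h\<bar> * M"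
      using N unfolding eq M_def is_norm_def by blast
    also have "\<dots> \<le> (2 / Q) * M"
    proof (intro mult_right_mono)
      have "1 / real n \<le> 2 / Q" using n Q1 by (simp add: field_simps)
      then show "\<bar>of_int k * u - of_int h\<bar> \<le> 2 / Q" using hk(3) by linarith
    qed (use M in simp)
    also have "\<dots> \<le> c * Q powr (- w)"
    proof -
      have "2 * M / c = ((2 * M / c) powr (1 / (1 - w))) powr (1 - w)"
        using w M c by (simp add: powr_powr)
      also have "\<dots> \<le> Q powr (1 - w)" using Q w by (intro powr_mono2) (auto simp: Q0_def)
      also have "\<dots> = Q * Q powr - w" using Q1 powr_add[of Q 1 "- w"] by simp
      finally show ?thesis using Q1 c by (simp add: field_simps)
    qed
    finally show ?thesis using hk n by (intro exI[of _ k] exI[of _ p]) auto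
  qed
  then show "\<exists>Q\<^sub>0. \<forall>Q\<ge>Q\<^sub>0. \<exists>(q::int) (p::int ^ 'm). 1 \<le> q \<and> real_of_int q \<le> Q \<and>
       N (real_of_int q *\<^sub>R axis i u - (\<chi> i. real_of_int (p $ i))) \<le> c * Q powr (- w)" by blast
qed

text \<open>Two coordinates of a point on a rational line satisfy a rational linear relation,
  obtained by eliminating the parameter of the line.\<close>

lemma totally_irrational_notin_rational_lines:
  fixes x :: "real ^ 'm::finite"
  assumes m: "CARD('m) \<ge> 2" and x: "totally_irrational x"
  shows "x \<notin> rational_lines"
proof
  assume "x \<in> rational_lines"
  then obtain a b t where ab: "a \<in> rational_points" "b \<in> rational_points" and xt: "x = a + t *\<^sub>R b"
    unfolding rational_lines_def by blast
  obtain i j :: 'm where ij: "i \<noteq> j" using m card_2_iff' [of "UNIV :: 'm set"]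
    by (metis (full_types) UNIV_I card_1_singletonE card_le_Suc0_iff_eq finite not_less_eq_eq numeral_2_eq_2)
  have "\<exists>r. v $ k = real_of_rat r" if "v \<in> rational_points" for v :: "real ^ 'm" and k
    using that unfolding rational_points_def by (auto elim: Rats_cases)
  then obtain \<alpha> \<beta> where \<alpha>: "\<And>k. a $ k = real_of_rat (\<alpha> k)" and \<beta>: "\<And>k. b $ k = real_of_rat (\<beta> k)"
    using ab by metis
  have sum2: "(\<Sum>k\<in>UNIV. of_rat ((\<lambda>k. if k = i then r else if k = j then s else 0) k) * x $ k)
      = of_rat r * x $ i + of_rat s * x $ j" for r s :: rat
  proof -
    have "(\<Sum>k\<in>UNIV. of_rat ((\<lambda>k. if k = i then r else if k = j then s else 0) k) * x $ k)
      = (\<Sum>k\<in>UNIV. (if k = i then of_rat r * x $ i else 0) + (if k = j then of_rat s * x $ j else 0))"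
      using ij by (intro sum.cong) auto
    then show ?thesis by (simp add: sum.distrib)
  qed
  have indep: "r = 0 \<and> s = 0" if "real_of_rat q + (of_rat r * x $ i + of_rat s * x $ j) = 0" for q r s
  proof -
    define c where "c = (\<lambda>k. if k = i then r else if k = j then s else 0)"
    have "real_of_rat q + (\<Sum>k\<in>UNIV. of_rat (c k) * x $ k) = 0"
      using that unfolding c_def sum2 .
    then have "\<forall>k. c k = 0" using x unfolding totally_irrational_def by blast
    from spec[OF this, of i] spec[OF this, of j] show ?thesis using ij by (simp add: c_def)
  qed
  have "real_of_rat (\<alpha> j * \<beta> i - \<alpha> i * \<beta> j) + (of_rat (\<beta> j) * x $ i + of_rat (- \<beta> i) * x $ j) = 0"
    by (simp add: xt \<alpha> \<beta> of_rat_add of_rat_diff of_rat_mult of_rat_minus algebra_simps)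
  from indep[OF this] have "\<beta> i = 0" by simp
  \<comment> \<open>Independence has made the elimination degenerate: now \<open>x $ i\<close>
    equals the rational \<open>\<alpha> i\<close>, a relation with coefficient 1.\<close>
  then have "real_of_rat (- \<alpha> i) + (of_rat 1 * x $ i + of_rat 0 * x $ j) = 0"
    by (simp add: xt \<alpha> \<beta> of_rat_minus)
  from indep[OF this] show False by simp
qed

lemma countable_rational_points: "countable (rational_points :: (real ^ 'm::finite) set)"
proof -
  have "countable (PiE (UNIV :: 'm set) (\<lambda>_. \<rat> :: real set))"
    by (intro countable_PiE) (auto simp: countable_rat)
  then have "countable (vec_lambda ` PiE (UNIV :: 'm set) (\<lambda>_. \<rat> :: real set))" by (rule countable_image)
  moreover have "rational_points \<subseteq> vec_lambda ` PiE (UNIV :: 'm set) (\<lambda>_. \<rat> :: real set)"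
  proof
    fix v :: "real ^ 'm" assume "v \<in> rational_points"
    then show "v \<in> vec_lambda ` PiE UNIV (\<lambda>_. \<rat>)"
      by (intro image_eqI[of _ _ "vec_nth v"]) (auto simp: rational_points_def)
  qed
  ultimately show ?thesis by (rule countable_subset[rotated])
qed

theorem theorem3p5:
  fixes \<epsilon> :: real
  assumes "CARD('m::finite) \<ge> 2" and "\<epsilon> > 0"
  shows "\<exists>w\<^sub>0::real. 0 \<le> w\<^sub>0 \<and> w\<^sub>0 < 1 \<and>
    (\<forall>(N :: real ^ 'm \<Rightarrow> real) w. is_norm N \<and> w\<^sub>0 < w \<and> w < 1 \<longrightarrow>
       hausdorff_dim (singular_set N w + singular_set N w) = 2 \<and>
       hausdorff_dim (singular_set_irr N w + singular_set_irr N w) \<le> ennreal (1 + \<epsilon>))"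
proof -

  \<comment> \<open>Choice of the parameters\<close>
  define m where "m = real CARD('m)"
  \<comment> \<open>The cap at 1 gives \<open>1 + \<epsilon>' \<le> 2\<close>, so the estimate for
    thin sets also applies in the proof of the upper bound 2.\<close>
  define \<epsilon>' where "\<epsilon>' = min \<epsilon> 1"
  \<comment> \<open>Chosen such that \<open>\<tau> * (\<epsilon>' / 2) = m + 2\<close>, which
    exceeds the \<open>m + 1\<close> required for convergence.\<close>
  define \<tau> where "\<tau> = 2 * (m + 2) / \<epsilon>'"
  \<comment> \<open>The three bounds ensure \<open>w \<ge> 1/2\<close>, box exponent
    \<open>t \<le> 1 + \<epsilon>' / 2\<close>, and \<open>\<tau> * (1 - w) < 1/4 \<le> w^2\<close>.
    None of them involves the norm.\<close>
  define \<eta> where "\<eta> = min (1/2) (min (\<epsilon>' / (8 * m)) (1 / (4 * \<tau>)))"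
  have m: "m \<ge> 2" using assms(1) by (simp add: m_def)
  have \<epsilon>': "0 < \<epsilon>'" "\<epsilon>' \<le> 1" "\<epsilon>' \<le> \<epsilon>" using assms(2) by (auto simp: \<epsilon>'_def)
  have \<tau>: "\<tau> > 0" using m \<epsilon>' by (simp add: \<tau>_def)
  have \<eta>: "0 < \<eta>" "\<eta> \<le> 1/2" "\<eta> \<le> \<epsilon>' / (8 * m)" "\<eta> \<le> 1 / (4 * \<tau>)"
    using m \<epsilon>' \<tau> unfolding \<eta>_def by auto
  show ?thesis
  proof (intro exI[of _ "1 - \<eta>"] conjI allI impI)
    show "0 \<le> 1 - \<eta>" "1 - \<eta> < 1" using \<eta> by auto
    fix N :: "real ^ 'm \<Rightarrow> real" and w
    assume "is_norm N \<and> 1 - \<eta> < w \<and> w < 1"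
    then have N: "is_norm N" and w\<eta>: "1 - w < \<eta>" and w1: "w < 1" by auto
    have w: "1/2 \<le> w" using w\<eta> \<eta> by linarith
    have \<tau>w: "\<tau> * (1 - w) < w\<^sup>2"
    proof -
      have "\<tau> * (1 - w) < \<tau> * (1 / (4 * \<tau>))" using w\<eta> \<eta> \<tau> by (intro mult_strict_left_mono) auto
      also have "\<dots> = (1/2)\<^sup>2" using \<tau> by (simp add: power2_eq_square)
      also have "\<dots> \<le> w\<^sup>2" using w by (intro power_mono) auto
      finally show ?thesis .
    qed
    define t where "t = 1 + 2 * m * (1 - w) / w"
    have t: "t \<le> 1 + \<epsilon>' / 2"
    proof -
      have "2 * m * (1 - w) / w \<le> 2 * m * (1 - w) / (1/2)" using w w1 m by (intro divide_left_mono) auto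
      also have "\<dots> = 4 * m * (1 - w)" by simp
      also have "\<dots> \<le> 4 * m * (\<epsilon>' / (8 * m))" using w\<eta> \<eta> m by (intro mult_left_mono) auto
      also have "\<dots> = \<epsilon>' / 2" using m by simp
      finally show ?thesis by (simp add: t_def)
    qed

    \<comment> \<open>Countable decomposition into bounded pieces\<close>
    define V :: "nat \<times> nat \<Rightarrow> (real ^ 'm) set" where
      "V = (\<lambda>(n, R). {x \<in> uniform_set w n - rational_lines. \<forall>i. \<bar>x $ i\<bar> \<le> real R})"
    define L :: "((real ^ 'm) \<times> (real ^ 'm)) \<times> nat \<Rightarrow> (real ^ 'm) set" where
      "L = (\<lambda>((a, b), R). (\<lambda>t. a + t *\<^sub>R b) ` {- real R..real R})"
    define \<V> where "\<V> = range V"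
    define \<L> where "\<L> = L ` ((rational_points \<times> rational_points) \<times> UNIV)"
    have countable: "countable \<V>" "countable \<L>"
      unfolding \<V>_def \<L>_def using countable_rational_points by auto
    have V_box: "box_bounded t X" if "X \<in> \<V>" for X
      using that box_bounded_uniform_set[OF w w1, where 'm = 'm] unfolding \<V>_def V_def t_def m_def by auto
    have L_box: "box_bounded 1 X" if "X \<in> \<L>" for X
      using that unfolding \<L>_def L_def by (auto intro!: box_bounded_segment)
    \<comment> \<open>\<open>X\<close> enters as a limsup set of very small dimension and
      \<open>Y\<close> through its box exponent. It is used with \<open>u = t\<close> for
      \<open>Y\<close> in \<open>\<V>\<close> and with \<open>u = 1\<close> for segments.\<close>
    have V_thin: "hausdorff_measure s (X + Y) = 0"
      if X: "X \<in> \<V>" and Y: "box_bounded u Y" and u: "u \<le> 1 + \<epsilon>' / 2" and s: "1 + \<epsilon>' \<le> s" for X Y u s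
    proof -
      obtain n R where X: "X = {x \<in> uniform_set w n - rational_lines. \<forall>i. \<bar>x $ i\<bar> \<le> real R}"
        using X unfolding \<V>_def V_def by auto
      show ?thesis
      proof (rule hausdorff_measure_plus_eq_0[OF _ _ Y _ \<tau>])
        show "\<bar>x $ i\<bar> \<le> real R" if "x \<in> X" for x i using that X by simp
        show "\<exists>q\<ge>K. 1 \<le> q \<and> approx_err x q \<le> real q powr - \<tau>" if "x \<in> X" for x K
          using that X by (intro very_well_approximable[OF _ _ w w1 \<tau> \<tau>w]) auto
        have "m + 2 = \<tau> * (\<epsilon>' / 2)" using \<epsilon>' by (simp add: \<tau>_def)
        also have "\<dots> \<le> \<tau> * (s - u)" using u s \<tau> by (intro mult_left_mono) auto
        finally show "real CARD('m) + 1 < \<tau> * (s - u)" by (simp add: m_def)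
      qed (use s \<epsilon>' in auto)
    qed
    have V_cover: "uniform_set w n - rational_lines \<subseteq> \<Union>\<V>" for n
    proof
      fix x :: "real ^ 'm" assume x: "x \<in> uniform_set w n - rational_lines"
      obtain R :: nat where R: "norm x \<le> real R" using real_arch_simple by blast
      have "\<bar>x $ i\<bar> \<le> real R" for i using component_le_norm_cart[of x i] R by linarith
      then have "x \<in> V (n, R)" using x by (simp add: V_def)
      then show "x \<in> \<Union>\<V>" unfolding \<V>_def by blast
    qed
    have L_cover: "rational_lines \<subseteq> \<Union>\<L>"
    proof
      fix x :: "real ^ 'm" assume "x \<in> rational_lines"
      then obtain a b u where ab: "a \<in> rational_points" "b \<in> rational_points" "x = a + u *\<^sub>R b"
        unfolding rational_lines_def by blast
      obtain R :: nat where "\<bar>u\<bar> \<le> real R" using real_arch_simple by blast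
      then have "x \<in> L ((a, b), R)" unfolding L_def using ab by (auto simp: abs_le_iff)
      then show "x \<in> \<Union>\<L>" unfolding \<L>_def using ab by blast
    qed
    have S_cover: "singular_set N w \<subseteq> \<Union>(\<V> \<union> \<L>)"
      using singular_set_subset_uniform_set[OF N, of w] V_cover L_cover by blast
    have S_irr_cover: "singular_set_irr N w \<subseteq> \<Union>\<V>"
      using singular_set_subset_uniform_set[OF N, of w] V_cover totally_irrational_notin_rational_lines[OF assms(1)]
      unfolding singular_set_irr_def by blast

    \<comment> \<open>The totally irrational part\<close>
    have "hausdorff_measure (1 + \<epsilon>) (singular_set_irr N w + singular_set_irr N w) = 0"
      using S_irr_cover countable(1)
    proof (rule hausdorff_measure_Union_plus_eq_0)
      show "\<V> \<noteq> {}" by (simp add: \<V>_def)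
      show "hausdorff_measure (1 + \<epsilon>) (X + Y) = 0" if "X \<in> \<V>" "Y \<in> \<V>" for X Y
        using V_thin[OF that(1) V_box[OF that(2)] t] \<epsilon>' by simp
    qed
    then show "hausdorff_dim (singular_set_irr N w + singular_set_irr N w) \<le> ennreal (1 + \<epsilon>)"
      using assms(2) by (intro hausdorff_dim_le) auto

    \<comment> \<open>Upper bound for the full singular set\<close>
    have S_null: "hausdorff_measure s (singular_set N w + singular_set N w) = 0" if s: "2 < s" for s
      using S_cover
    proof (rule hausdorff_measure_Union_plus_eq_0)
      show "countable (\<V> \<union> \<L>)" using countable by simp
      show "\<V> \<union> \<L> \<noteq> {}" by (simp add: \<V>_def)
      have s': "1 + \<epsilon>' \<le> s" "1 \<le> 1 + \<epsilon>' / 2" using s \<epsilon>' by auto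
      \<comment> \<open>The only pairs that can reach dimension 2: each segment has box exponent
        1.\<close>
      have L2: "hausdorff_measure s (X + Y) = 0" if "X \<in> \<L>" "Y \<in> \<L>" for X Y
        using box_bounded_plus[OF L_box[OF that(1)] L_box[OF that(2)]] s
        by (intro hausdorff_measure_box_bounded_eq_0[of 2]) auto
      have VL: "hausdorff_measure s (X + Y) = 0" if "X \<in> \<V>" "Y \<in> \<L>" for X Y
        by (rule V_thin[OF that(1) L_box[OF that(2)] s'(2,1)])
      show "hausdorff_measure s (X + Y) = 0" if "X \<in> \<V> \<union> \<L>" "Y \<in> \<V> \<union> \<L>" for X Y
        using that VL L2 V_thin[OF _ V_box t s'(1)] by (metis Un_iff add.commute)
    qed
    show "hausdorff_dim (singular_set N w + singular_set N w) = 2"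
    proof (rule antisym)
      show "hausdorff_dim (singular_set N w + singular_set N w) \<le> 2"
      proof (rule ennreal_le_epsilon)
        fix e :: real assume "0 < e"
        then have "hausdorff_dim (singular_set N w + singular_set N w) \<le> ennreal (2 + e)"
          by (intro hausdorff_dim_le S_null) auto
        also have "\<dots> = 2 + ennreal e" using \<open>0 < e\<close> by (simp add: ennreal_plus)
        finally show "hausdorff_dim (singular_set N w + singular_set N w) \<le> 2 + ennreal e" .
      qed

      \<comment> \<open>Lower bound from a coordinate plane\<close>
      obtain i j :: 'm where ij: "i \<noteq> j"
        using assms(1) card_le_Suc0_iff_eq[of "UNIV :: 'm set"] by (auto simp: not_le numeral_2_eq_2)
      have plane: "axis i u + axis j v \<in> singular_set N w + singular_set N w" for u v
        using axis_in_singular_set[OF N w1] by (intro set_plus_intro)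
      show "2 \<le> hausdorff_dim (singular_set N w + singular_set N w)"
        unfolding hausdorff_dim_def
      proof (rule Inf_greatest)
        fix z assume "z \<in> {ennreal s |s. 0 \<le> s \<and> hausdorff_measure s (singular_set N w + singular_set N w) = 0}"
        then obtain s where s: "z = ennreal s" "0 \<le> s" 
          "hausdorff_measure s (singular_set N w + singular_set N w) = 0" by blast
        have "\<not> s < 2" using hausdorff_measure_plane_neq_0[OF ij s(2) _ plane] s(3) by blast
        then have "ennreal 2 \<le> ennreal s" by (intro ennreal_leI) simp
        then show "2 \<le> z" using s(1) by simp
      qed
    qed
  qed
qed

end
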